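(* Let $m$ and $a$ be mutually prime integers with $m>1$ and $0<a<m$. Then for every $\sigma\in G_{\mathbb{Q}(\mu_m)}$ there exists a measure $\hat\zeta_{a,m}(\sigma)\in\hat{\mathbb{Z}}[[\hat{\mathbb{Z}}]]$ such that for every prime $p$ its image $\hat\zeta_{p,a,m}(\sigma)\in\mathbb{Z}_p[[\mathbb{Z}_p]]$ satisfies, for all integers $k\ge 1$, $$\int_{\mathbb{Z}_p^\times} b^{k-1}\,d\hat\zeta_{p,a,m}(\sigma)(b)=\begin{cases}(1-\chi_p(\sigma)^k)\, m^{k-1}\,\frac{1}{k}B_k\!\left(\frac{a}{m}\right), & p\mid m,\\[2mm] (1-\chi_p(\sigma)^k)\, m^{k-1}\left(\frac{1}{k}B_k\!\left(\frac{a}{m}\right)-\frac{p^{k-1}}{k}B_k\!\left(\frac{\langle ap^{-1}\rangle}{m}\right)\right), & p\nmid m.\end{cases}$$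
   Context: Fix an embedding $\overline{\mathbb{Q}}\subset\mathbb{C}$; for a subfield $F\subset\mathbb{C}$, $G_F=\mathrm{Gal}(\overline F/F)$, and $\mu_m$ is the group of $m$-th roots of unity. $\hat{\mathbb{Z}}=\varprojlim_N\mathbb{Z}/N\mathbb{Z}$, and $\hat{\mathbb{Z}}[[\hat{\mathbb{Z}}]]=\varprojlim_N \hat{\mathbb{Z}}[\mathbb{Z}/N\mathbb{Z}]$ is the algebra of $\hat{\mathbb{Z}}$-valued measures on $\hat{\mathbb{Z}}$; its image in $\mathbb{Z}_p[[\mathbb{Z}_p]]=\varprojlim_n\mathbb{Z}_p[\mathbb{Z}/p^n\mathbb{Z}]$ is obtained by projecting coefficients $\hat{\mathbb{Z}}\to\mathbb{Z}_p$ and pushing forward along $\hat{\mathbb{Z}}\to\mathbb{Z}_p$. $\chi_p:G_{\mathbb{Q}}\to\mathbb{Z}_p^\times$ is the $p$-adic cyclotomic character. The Bernoulli polynomials are defined by $\sum_{k\ge0}B_k(T)\frac{w^k}{k!}=\frac{we^{Tw}}{e^w-1}$. When $p\nmid m$, $\langle ap^{-1}\rangle$ denotes the least positive integer such that $\langle ap^{-1}\rangle p\equiv a \pmod m$. *)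

theory Defs
  imports
    "HOL-Algebra.Algebra"
    "HOL-Algebra.Algebraic_Closure_Type"
    "HOL-Number_Theory.Cong"
    "HOL-Computational_Algebra.Computational_Algebra"
begin

section \<open>Subfields of the complex numbers and their absolute Galois groups\<close>

abbreviation CC :: "complex ring" where
  "CC \<equiv> ring_of_type_algebra"

definition roots_of_unity :: "nat \<Rightarrow> complex set" where
  "roots_of_unity m = {z. z ^ m = 1}"

text \<open>The prime field of \<open>CC\<close> is \<open>\<rat>\<close>, so \<open>generate_field CC H\<close> is \<open>\<rat>(H)\<close>.\<close>

definition cyclotomic_field :: "nat \<Rightarrow> complex set" where
  "cyclotomic_field m = generate_field CC (roots_of_unity m)"

definition alg_closure_in_complex :: "complex set \<Rightarrow> complex set" where
  "alg_closure_in_complex F =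
     {z. \<exists>q :: complex poly. q \<noteq> 0 \<and> (\<forall>i. Polynomial.coeff q i \<in> F) \<and> poly q z = 0}"

text \<open>The automorphisms of the algebraic closure of \<open>F\<close> inside the complex numbers that fix \<open>F\<close>
  pointwise. For \<open>F\<close> algebraic over \<open>\<rat>\<close> this closure is the field of all algebraic numbers, so that
  the group for \<open>F\<close> is literally a subgroup of the one for \<open>\<rat>\<close>. Being total functions in HOL, the
  automorphisms are normalised to \<open>undefined\<close> outside the closure.\<close>

definition absolute_Galois_group :: "complex set \<Rightarrow> (complex \<Rightarrow> complex) set" where
  "absolute_Galois_group F =
     {\<sigma> \<in> extensional (alg_closure_in_complex F).
        \<sigma> \<in> ring_iso (CC\<lparr>carrier := alg_closure_in_complex F\<rparr>)
                     (CC\<lparr>carrier := alg_closure_in_complex F\<rparr>) \<and>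
        (\<forall>x\<in>F. \<sigma> x = x)}"


section \<open>Inverse limits of the rings \<open>\<int>/N\<int>\<close>\<close>

text \<open>For a set \<open>S\<close> of positive integers, directed by divisibility, \<open>Zlim S\<close> is the inverse limit of
  the rings \<open>\<int>/N\<int>\<close> for \<open>N \<in> S\<close>; residue classes mod \<open>N\<close> are represented by \<open>{0..<N}\<close>, and the
  transition map from level \<open>M\<close> to a divisor \<open>N\<close> of \<open>M\<close> is reduction mod \<open>N\<close>. The index set of the
  profinite integers is all \<open>N > 0\<close>, that of the \<open>p\<close>-adic integers is the set of powers of \<open>p\<close>.\<close>

definition Zlim :: "nat set \<Rightarrow> (nat \<Rightarrow> int) ring" where
  "Zlim S =
     \<lparr>carrier = {x \<in> (\<Pi>\<^sub>E N\<in>S. {0..<int N}). \<forall>N\<in>S. \<forall>M\<in>S. N dvd M \<longrightarrow> x M mod int N = x N},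
      monoid.mult = (\<lambda>x y. \<lambda>N\<in>S. (x N * y N) mod int N),
      monoid.one = (\<lambda>N\<in>S. 1 mod int N),
      ring.zero = (\<lambda>N\<in>S. 0),
      ring.add = (\<lambda>x y. \<lambda>N\<in>S. (x N + y N) mod int N)\<rparr>"

definition Zlim_of_int :: "nat set \<Rightarrow> int \<Rightarrow> nat \<Rightarrow> int" where
  "Zlim_of_int S u = (\<lambda>N\<in>S. u mod int N)"

definition Zhat_index :: "nat set" where
  "Zhat_index = {0<..}"

definition Zp_index :: "nat \<Rightarrow> nat set" where
  "Zp_index p = range (\<lambda>n. p ^ n)"

abbreviation Zhat :: "(nat \<Rightarrow> int) ring" where
  "Zhat \<equiv> Zlim Zhat_index"

abbreviation Zp :: "nat \<Rightarrow> (nat \<Rightarrow> int) ring" where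
  "Zp p \<equiv> Zlim (Zp_index p)"

lemma cring_Zlim:
  assumes "0 \<notin> S"
  shows "cring (Zlim S)"
proof -
  have pos: "0 < int N" if "N \<in> S" for N
    using assms that by (cases N) auto
  have car: "(\<lambda>N\<in>S. f N mod int N) \<in> carrier (Zlim S)"
    if f: "\<And>N M. N \<in> S \<Longrightarrow> M \<in> S \<Longrightarrow> N dvd M \<Longrightarrow> f M mod int N = f N mod int N" for f
  proof -
    have "f M mod int M mod int N = f N mod int N" if "N \<in> S" "M \<in> S" "N dvd M" for N M
      using f[OF that] that(3) by (simp add: mod_mod_cancel)
    then show ?thesis
      using pos by (auto simp: Zlim_def)
  qed
  have compat: "x M mod int N = x N mod int N"
    if "x \<in> carrier (Zlim S)" "N \<in> S" "M \<in> S" "N dvd M" for x N M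
    using that by (auto simp: Zlim_def)
  have closed_mult: "x \<otimes>\<^bsub>Zlim S\<^esub> y \<in> carrier (Zlim S)"
    if "x \<in> carrier (Zlim S)" "y \<in> carrier (Zlim S)" for x y
    using car[of "\<lambda>N. x N * y N", OF mod_mult_cong[OF compat compat]] that
    unfolding Zlim_def by simp
  have closed_add: "x \<oplus>\<^bsub>Zlim S\<^esub> y \<in> carrier (Zlim S)"
    if "x \<in> carrier (Zlim S)" "y \<in> carrier (Zlim S)" for x y
    using car[of "\<lambda>N. x N + y N", OF mod_add_cong[OF compat compat]] that
    unfolding Zlim_def by simp
  have closed_neg: "(\<lambda>N\<in>S. (- x N) mod int N) \<in> carrier (Zlim S)"
    if "x \<in> carrier (Zlim S)" for x
    using car[of "\<lambda>N. - x N", OF mod_minus_cong[OF compat]] that by blast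
  have closed_consts: "\<one>\<^bsub>Zlim S\<^esub> \<in> carrier (Zlim S)" "\<zero>\<^bsub>Zlim S\<^esub> \<in> carrier (Zlim S)"
    using car[of "\<lambda>_. 1"] car[of "\<lambda>_. 0"] by (simp_all add: Zlim_def)
  have ext: "x \<in> extensional S" if "x \<in> carrier (Zlim S)" for x
    using that by (simp add: Zlim_def PiE_def)
  have red: "x N mod int N = x N" if "x \<in> carrier (Zlim S)" "N \<in> S" for x N
    using that unfolding Zlim_def by simp
  have nth: "(x \<otimes>\<^bsub>Zlim S\<^esub> y) N = (x N * y N) mod int N" "(x \<oplus>\<^bsub>Zlim S\<^esub> y) N = (x N + y N) mod int N"
    "\<one>\<^bsub>Zlim S\<^esub> N = 1 mod int N" "\<zero>\<^bsub>Zlim S\<^esub> N = 0" if "N \<in> S" for x y N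
    using that by (simp_all add: Zlim_def)
  note closed = closed_mult closed_add closed_consts
  note rules = closed nth red ext mod_simps
  have "abelian_group (Zlim S)"
  proof (rule abelian_groupI)
    fix x assume x: "x \<in> carrier (Zlim S)"
    let ?y = "\<lambda>N\<in>S. (- x N) mod int N"
    have "?y \<oplus>\<^bsub>Zlim S\<^esub> x = \<zero>\<^bsub>Zlim S\<^esub>"
      by (intro extensionalityI[of _ S])
        (simp_all add: nth ext closed closed_neg x mod_add_left_eq)
    with closed_neg[OF x] show "\<exists>y\<in>carrier (Zlim S). y \<oplus>\<^bsub>Zlim S\<^esub> x = \<zero>\<^bsub>Zlim S\<^esub>"
      by (intro bexI[of _ ?y])
  next
    fix x y z assume "x \<in> carrier (Zlim S)" "y \<in> carrier (Zlim S)" "z \<in> carrier (Zlim S)"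
    then show "x \<oplus>\<^bsub>Zlim S\<^esub> y \<oplus>\<^bsub>Zlim S\<^esub> z = x \<oplus>\<^bsub>Zlim S\<^esub> (y \<oplus>\<^bsub>Zlim S\<^esub> z)"
      by (intro extensionalityI[of _ S]) (simp_all add: rules add.assoc)
  next
    fix x y assume "x \<in> carrier (Zlim S)" "y \<in> carrier (Zlim S)"
    then show "x \<oplus>\<^bsub>Zlim S\<^esub> y = y \<oplus>\<^bsub>Zlim S\<^esub> x"
      by (intro extensionalityI[of _ S]) (simp_all add: rules add.commute)
  next
    fix x assume "x \<in> carrier (Zlim S)"
    then show "\<zero>\<^bsub>Zlim S\<^esub> \<oplus>\<^bsub>Zlim S\<^esub> x = x"
      by (intro extensionalityI[of _ S]) (simp_all add: rules)
  qed (simp_all add: closed)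
  moreover have "comm_monoid (Zlim S)"
  proof (rule comm_monoidI)
    fix x y z assume "x \<in> carrier (Zlim S)" "y \<in> carrier (Zlim S)" "z \<in> carrier (Zlim S)"
    then show "x \<otimes>\<^bsub>Zlim S\<^esub> y \<otimes>\<^bsub>Zlim S\<^esub> z = x \<otimes>\<^bsub>Zlim S\<^esub> (y \<otimes>\<^bsub>Zlim S\<^esub> z)"
      by (intro extensionalityI[of _ S]) (simp_all add: rules mult.assoc)
  next
    fix x y assume "x \<in> carrier (Zlim S)" "y \<in> carrier (Zlim S)"
    then show "x \<otimes>\<^bsub>Zlim S\<^esub> y = y \<otimes>\<^bsub>Zlim S\<^esub> x"
      by (intro extensionalityI[of _ S]) (simp_all add: rules mult.commute)
  next
    fix x assume "x \<in> carrier (Zlim S)"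
    then show "\<one>\<^bsub>Zlim S\<^esub> \<otimes>\<^bsub>Zlim S\<^esub> x = x"
      by (intro extensionalityI[of _ S]) (simp_all add: rules)
  qed (simp_all add: closed)
  ultimately show ?thesis
  proof (rule cringI)
    fix x y z assume "x \<in> carrier (Zlim S)" "y \<in> carrier (Zlim S)" "z \<in> carrier (Zlim S)"
    then show "(x \<oplus>\<^bsub>Zlim S\<^esub> y) \<otimes>\<^bsub>Zlim S\<^esub> z = x \<otimes>\<^bsub>Zlim S\<^esub> z \<oplus>\<^bsub>Zlim S\<^esub> y \<otimes>\<^bsub>Zlim S\<^esub> z"
      by (intro extensionalityI[of _ S]) (simp_all add: rules distrib_right)
  qed
qed

lemma domain_Zp:
  assumes "Factorial_Ring.prime p"
  shows "domain (Zp p)"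
proof -
  interpret cring "Zp p"
    by (rule cring_Zlim) (use assms in \<open>auto simp: Zp_index_def prime_gt_0_nat\<close>)
  show ?thesis
  proof
    have "\<one>\<^bsub>Zp p\<^esub> p = 1" "\<zero>\<^bsub>Zp p\<^esub> p = 0"
      using prime_gt_1_nat[OF assms] rangeI[of "\<lambda>n. p ^ n" 1]
      by (auto simp: Zlim_def Zp_index_def)
    then show "\<one>\<^bsub>Zp p\<^esub> \<noteq> \<zero>\<^bsub>Zp p\<^esub>"
      by force
  next
    fix x y assume xy: "x \<otimes>\<^bsub>Zp p\<^esub> y = \<zero>\<^bsub>Zp p\<^esub>" "x \<in> carrier (Zp p)" "y \<in> carrier (Zp p)"
    show "x = \<zero>\<^bsub>Zp p\<^esub> \<or> y = \<zero>\<^bsub>Zp p\<^esub>"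
    proof (rule ccontr)
      have nz: "\<exists>i. z (p ^ i) \<noteq> 0" if "z \<in> carrier (Zp p)" "z \<noteq> \<zero>\<^bsub>Zp p\<^esub>" for z
      proof (rule ccontr)
        assume "\<nexists>i. z (p ^ i) \<noteq> 0"
        then have "z = \<zero>\<^bsub>Zp p\<^esub>"
          using that(1) by (intro extensionalityI[where A = "Zp_index p"])
            (auto simp: Zlim_def Zp_index_def PiE_iff)
        with that show False by simp
      qed
      assume "\<not> (x = \<zero>\<^bsub>Zp p\<^esub> \<or> y = \<zero>\<^bsub>Zp p\<^esub>)"
      with nz xy obtain i j where ij: "x (p ^ i) \<noteq> 0" "y (p ^ j) \<noteq> 0"
        by metis
      let ?M = "p ^ (i + j)"
      have red: "z ?M mod int (p ^ l) = z (p ^ l)" if "z \<in> carrier (Zp p)" "l \<le> i + j" for z l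
        using that by (auto simp: Zlim_def Zp_index_def le_imp_power_dvd)
      have ndvd: "\<not> int p ^ i dvd x ?M" "\<not> int p ^ j dvd y ?M"
        using red[of x i] red[of y j] ij xy by (auto simp: dvd_eq_mod_eq_0)
      have "(x \<otimes>\<^bsub>Zp p\<^esub> y) ?M = (x ?M * y ?M) mod int ?M" "\<zero>\<^bsub>Zp p\<^esub> ?M = 0"
        by (auto simp: Zlim_def Zp_index_def)
      with xy have "int p ^ (i + j) dvd x ?M * y ?M"
        by (simp add: dvd_eq_mod_eq_0)
      moreover have p: "prime_elem (int p)"
        using assms by simp
      moreover have nz: "x ?M \<noteq> 0" "y ?M \<noteq> 0"
        using ndvd by auto
      ultimately have "i + j \<le> multiplicity (int p) (x ?M) + multiplicity (int p) (y ?M)"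
        using prime_elem_not_unit[OF p]
        by (simp add: power_dvd_iff_le_multiplicity flip: prime_elem_multiplicity_mult_distrib)
      moreover have "multiplicity (int p) (x ?M) < i" "multiplicity (int p) (y ?M) < j"
        using ndvd nz prime_elem_not_unit[OF p] by (simp_all add: power_dvd_iff_le_multiplicity)
      ultimately show False
        by linarith
    qed
  qed
qed


section \<open>Fields of fractions\<close>

definition frac_rel :: "('a, 'b) ring_scheme \<Rightarrow> (('a \<times> 'a) \<times> ('a \<times> 'a)) set" where
  "frac_rel R =
     {((a, b), (c, d)). a \<in> carrier R \<and> b \<in> carrier R - {\<zero>\<^bsub>R\<^esub>} \<and>
        c \<in> carrier R \<and> d \<in> carrier R - {\<zero>\<^bsub>R\<^esub>} \<and> a \<otimes>\<^bsub>R\<^esub> d = c \<otimes>\<^bsub>R\<^esub> b}"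

definition fraction :: "('a, 'b) ring_scheme \<Rightarrow> 'a \<Rightarrow> 'a \<Rightarrow> ('a \<times> 'a) set" where
  "fraction R a b = frac_rel R `` {(a, b)}"

definition Frac :: "('a, 'b) ring_scheme \<Rightarrow> ('a \<times> 'a) set ring" where
  "Frac R =
     \<lparr>carrier = (carrier R \<times> (carrier R - {\<zero>\<^bsub>R\<^esub>})) // frac_rel R,
      monoid.mult = (\<lambda>A B. \<Union>(a, b)\<in>A. \<Union>(c, d)\<in>B. fraction R (a \<otimes>\<^bsub>R\<^esub> c) (b \<otimes>\<^bsub>R\<^esub> d)),
      monoid.one = fraction R \<one>\<^bsub>R\<^esub> \<one>\<^bsub>R\<^esub>,
      ring.zero = fraction R \<zero>\<^bsub>R\<^esub> \<one>\<^bsub>R\<^esub>,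
      ring.add = (\<lambda>A B. \<Union>(a, b)\<in>A. \<Union>(c, d)\<in>B.
               fraction R (a \<otimes>\<^bsub>R\<^esub> d \<oplus>\<^bsub>R\<^esub> c \<otimes>\<^bsub>R\<^esub> b) (b \<otimes>\<^bsub>R\<^esub> d))\<rparr>"

lemma UN2_constant:
  assumes "\<And>a b c d. (a, b) \<in> A \<Longrightarrow> (c, d) \<in> B \<Longrightarrow> f a b c d = C" "A \<noteq> {}" "B \<noteq> {}"
  shows "(\<Union>(a, b)\<in>A. \<Union>(c, d)\<in>B. f a b c d) = C"
proof -
  have "(\<Union>(a, b)\<in>A. \<Union>(c, d)\<in>B. f a b c d) = (\<Union>_\<in>A. \<Union>_\<in>B. C)"
    using assms(1) by (intro SUP_cong refl) (auto split: prod.splits intro!: SUP_cong)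
  with assms(2,3) show ?thesis
    by simp
qed

context domain
begin

lemma equiv_frac_rel: "equiv (carrier R \<times> (carrier R - {\<zero>})) (frac_rel R)"
proof (rule equivI)
  show "trans (frac_rel R)"
  proof (rule transI, clarify)
    fix a b c d e f
    assume *: "((a, b), (c, d)) \<in> frac_rel R" "((c, d), (e, f)) \<in> frac_rel R"
    then have car: "a \<in> carrier R" "b \<in> carrier R" "c \<in> carrier R" "d \<in> carrier R"
      "e \<in> carrier R" "f \<in> carrier R" and d: "d \<noteq> \<zero>"
      and eq: "a \<otimes> d = c \<otimes> b" "c \<otimes> f = e \<otimes> d"
      by (auto simp: frac_rel_def)
    have "d \<otimes> (a \<otimes> f) = (a \<otimes> d) \<otimes> f"
      using car by (simp add: m_ac)
    also have "\<dots> = (c \<otimes> f) \<otimes> b"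
      unfolding eq(1) using car by (simp add: m_ac)
    also have "\<dots> = d \<otimes> (e \<otimes> b)"
      unfolding eq(2) using car by (simp add: m_ac)
    finally have "a \<otimes> f = e \<otimes> b"
      using m_lcancel[of d "a \<otimes> f" "e \<otimes> b"] car d by simp
    with * show "((a, b), (e, f)) \<in> frac_rel R"
      by (auto simp: frac_rel_def)
  qed
qed (auto simp: frac_rel_def refl_on_def sym_def)

lemma fraction_eq_iff:
  assumes "a \<in> carrier R" "b \<in> carrier R - {\<zero>}" "c \<in> carrier R" "d \<in> carrier R - {\<zero>}"
  shows "fraction R a b = fraction R c d \<longleftrightarrow> a \<otimes> d = c \<otimes> b"
  unfolding fraction_def using assms
  by (subst eq_equiv_class_iff[OF equiv_frac_rel]) (auto simp: frac_rel_def)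

lemma fraction_mult:
  assumes "a \<in> carrier R" "b \<in> carrier R - {\<zero>}" "c \<in> carrier R" "d \<in> carrier R - {\<zero>}"
  shows "fraction R a b \<otimes>\<^bsub>Frac R\<^esub> fraction R c d = fraction R (a \<otimes> c) (b \<otimes> d)"
proof -
  have "fraction R (a' \<otimes> c') (b' \<otimes> d') = fraction R (a \<otimes> c) (b \<otimes> d)"
    if "(a', b') \<in> fraction R a b" "(c', d') \<in> fraction R c d" for a' b' c' d'
  proof -
    have car: "a' \<in> carrier R" "b' \<in> carrier R" "b' \<noteq> \<zero>" "c' \<in> carrier R" "d' \<in> carrier R"
      "d' \<noteq> \<zero>" and eq: "a \<otimes> b' = a' \<otimes> b" "c \<otimes> d' = c' \<otimes> d"
      using that by (auto simp: fraction_def frac_rel_def)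
    have "(a' \<otimes> c') \<otimes> (b \<otimes> d) = (a' \<otimes> b) \<otimes> (c' \<otimes> d)"
      using car assms by (simp add: m_ac)
    also have "\<dots> = (a \<otimes> c) \<otimes> (b' \<otimes> d')"
      unfolding eq[symmetric] using car assms by (simp add: m_ac)
    finally show ?thesis
      using car assms by (simp add: fraction_eq_iff integral_iff)
  qed
  moreover have "(a, b) \<in> fraction R a b" "(c, d) \<in> fraction R c d"
    using assms by (auto simp: fraction_def frac_rel_def)
  ultimately show ?thesis
    unfolding Frac_def ring.simps monoid.simps by (intro UN2_constant) blast+
qed

lemma fraction_add:
  assumes "a \<in> carrier R" "b \<in> carrier R - {\<zero>}" "c \<in> carrier R" "d \<in> carrier R - {\<zero>}"
  shows "fraction R a b \<oplus>\<^bsub>Frac R\<^esub> fraction R c d = fraction R (a \<otimes> d \<oplus> c \<otimes> b) (b \<otimes> d)"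
proof -
  have "fraction R (a' \<otimes> d' \<oplus> c' \<otimes> b') (b' \<otimes> d') = fraction R (a \<otimes> d \<oplus> c \<otimes> b) (b \<otimes> d)"
    if "(a', b') \<in> fraction R a b" "(c', d') \<in> fraction R c d" for a' b' c' d'
  proof -
    have car: "a' \<in> carrier R" "b' \<in> carrier R" "b' \<noteq> \<zero>" "c' \<in> carrier R" "d' \<in> carrier R"
      "d' \<noteq> \<zero>" and eq: "a \<otimes> b' = a' \<otimes> b" "c \<otimes> d' = c' \<otimes> d"
      using that by (auto simp: fraction_def frac_rel_def)
    have "(a' \<otimes> d' \<oplus> c' \<otimes> b') \<otimes> (b \<otimes> d) = (a' \<otimes> b) \<otimes> (d' \<otimes> d) \<oplus> (c' \<otimes> d) \<otimes> (b' \<otimes> b)"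
      using car assms by (simp add: m_ac a_ac l_distr r_distr)
    also have "\<dots> = (a \<otimes> d \<oplus> c \<otimes> b) \<otimes> (b' \<otimes> d')"
      unfolding eq[symmetric] using car assms by (simp add: m_ac a_ac l_distr r_distr)
    finally show ?thesis
      using car assms by (simp add: fraction_eq_iff integral_iff)
  qed
  moreover have "(a, b) \<in> fraction R a b" "(c, d) \<in> fraction R c d"
    using assms by (auto simp: fraction_def frac_rel_def)
  ultimately show ?thesis
    unfolding Frac_def ring.simps monoid.simps by (intro UN2_constant) blast+
qed

lemma fraction_closed:
  "a \<in> carrier R \<Longrightarrow> b \<in> carrier R - {\<zero>} \<Longrightarrow> fraction R a b \<in> carrier (Frac R)"
  by (auto simp: Frac_def fraction_def intro!: quotientI)

lemma FracE:
  assumes "x \<in> carrier (Frac R)"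
  obtains a b where "a \<in> carrier R" "b \<in> carrier R" "b \<noteq> \<zero>" "x = fraction R a b"
  using assms by (auto simp: Frac_def fraction_def quotient_def)

lemma field_Frac: "field (Frac R)"
proof -
  note fr = fraction_mult fraction_add fraction_eq_iff integral_iff fraction_closed
  have one: "\<one>\<^bsub>Frac R\<^esub> = fraction R \<one> \<one>" and zero: "\<zero>\<^bsub>Frac R\<^esub> = fraction R \<zero> \<one>"
    by (simp_all add: Frac_def)
  have "abelian_group (Frac R)"
  proof (rule abelian_groupI)
    fix x assume "x \<in> carrier (Frac R)"
    then obtain a b where x: "a \<in> carrier R" "b \<in> carrier R" "b \<noteq> \<zero>" "x = fraction R a b"
      by (rule FracE)
    then have "fraction R (\<ominus> a) b \<in> carrier (Frac R)"
      "fraction R (\<ominus> a) b \<oplus>\<^bsub>Frac R\<^esub> x = \<zero>\<^bsub>Frac R\<^esub>"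
      by (simp_all add: zero fr l_minus l_neg)
    then show "\<exists>y\<in>carrier (Frac R). y \<oplus>\<^bsub>Frac R\<^esub> x = \<zero>\<^bsub>Frac R\<^esub>" ..
  next
    fix x y z assume "x \<in> carrier (Frac R)" "y \<in> carrier (Frac R)" "z \<in> carrier (Frac R)"
    then show "x \<oplus>\<^bsub>Frac R\<^esub> y \<oplus>\<^bsub>Frac R\<^esub> z = x \<oplus>\<^bsub>Frac R\<^esub> (y \<oplus>\<^bsub>Frac R\<^esub> z)"
      by (elim FracE) (simp add: fr m_ac a_ac l_distr r_distr)
  next
    fix x y assume "x \<in> carrier (Frac R)" "y \<in> carrier (Frac R)"
    then show "x \<oplus>\<^bsub>Frac R\<^esub> y = y \<oplus>\<^bsub>Frac R\<^esub> x"
      by (elim FracE) (simp add: fr m_ac a_ac l_distr r_distr)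
  qed (auto elim!: FracE simp: zero fr)
  moreover have "comm_monoid (Frac R)"
    by (rule comm_monoidI) (auto elim!: FracE simp: one fr m_ac)
  ultimately have "cring (Frac R)"
  proof (rule cringI)
    fix x y z assume "x \<in> carrier (Frac R)" "y \<in> carrier (Frac R)" "z \<in> carrier (Frac R)"
    then show "(x \<oplus>\<^bsub>Frac R\<^esub> y) \<otimes>\<^bsub>Frac R\<^esub> z = x \<otimes>\<^bsub>Frac R\<^esub> z \<oplus>\<^bsub>Frac R\<^esub> y \<otimes>\<^bsub>Frac R\<^esub> z"
      by (elim FracE) (simp add: fr m_ac a_ac l_distr r_distr)
  qed
  then show ?thesis
  proof (rule cring.cring_fieldI2)
    show "\<zero>\<^bsub>Frac R\<^esub> \<noteq> \<one>\<^bsub>Frac R\<^esub>"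
      by (simp add: one zero fr)
    fix x assume "x \<in> carrier (Frac R)" "x \<noteq> \<zero>\<^bsub>Frac R\<^esub>"
    then obtain a b where x: "a \<in> carrier R - {\<zero>}" "b \<in> carrier R - {\<zero>}" "x = fraction R a b"
      by (elim FracE) (auto simp: zero fr)
    then have "fraction R b a \<in> carrier (Frac R)" "x \<otimes>\<^bsub>Frac R\<^esub> fraction R b a = \<one>\<^bsub>Frac R\<^esub>"
      by (simp_all add: one fr m_ac)
    then show "\<exists>y\<in>carrier (Frac R). x \<otimes>\<^bsub>Frac R\<^esub> y = \<one>\<^bsub>Frac R\<^esub>" ..
  qed
qed

end

abbreviation Qp :: "nat \<Rightarrow> ((nat \<Rightarrow> int) \<times> (nat \<Rightarrow> int)) set ring" where
  "Qp p \<equiv> Frac (Zp p)"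

definition Qp_of_Zp :: "nat \<Rightarrow> (nat \<Rightarrow> int) \<Rightarrow> ((nat \<Rightarrow> int) \<times> (nat \<Rightarrow> int)) set" where
  "Qp_of_Zp p x = fraction (Zp p) x \<one>\<^bsub>Zp p\<^esub>"

definition Qp_of_rat :: "nat \<Rightarrow> rat \<Rightarrow> ((nat \<Rightarrow> int) \<times> (nat \<Rightarrow> int)) set" where
  "Qp_of_rat p r = (case quotient_of r of (u, v) \<Rightarrow>
     fraction (Zp p) (Zlim_of_int (Zp_index p) u) (Zlim_of_int (Zp_index p) v))"


section \<open>The cyclotomic character\<close>

text \<open>\<open>\<chi>\<^sub>p(\<sigma>)\<close> is the element of \<open>\<int>\<^sub>p\<close> with \<open>\<sigma>(\<zeta>) = \<zeta>\<^bsup>\<chi>\<^sub>p(\<sigma>)\<^esup>\<close> for all \<open>\<zeta>\<close> of \<open>p\<close>-power order.\<close>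

definition cyclotomic_character :: "nat \<Rightarrow> (complex \<Rightarrow> complex) \<Rightarrow> nat \<Rightarrow> int" where
  "cyclotomic_character p \<sigma> =
     (THE c. c \<in> carrier (Zp p) \<and>
        (\<forall>n. \<forall>\<zeta>\<in>roots_of_unity (p ^ n). \<sigma> \<zeta> = \<zeta> ^ nat (c (p ^ n))))"


section \<open>Measures\<close>

text \<open>\<open>measure_algebra S T\<close> is \<open>\<Lambda>[[X]]\<close> for \<open>\<Lambda> = Zlim S\<close> and \<open>X = Zlim T\<close>, that is, the inverse limit of
  the group algebras \<open>\<Lambda>[\<int>/N\<int>]\<close> for \<open>N \<in> T\<close>. The value \<open>\<mu> N r\<close> is the coefficient of the residue
  class \<open>r\<close> mod \<open>N\<close>, i.e. the measure of the set of all \<open>x \<in> X\<close> with \<open>x N = r\<close>.\<close>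

definition measure_algebra :: "nat set \<Rightarrow> nat set \<Rightarrow> (nat \<Rightarrow> int \<Rightarrow> nat \<Rightarrow> int) set" where
  "measure_algebra S T =
     {\<mu> \<in> (\<Pi>\<^sub>E N\<in>T. {0..<int N} \<rightarrow>\<^sub>E carrier (Zlim S)).
        \<forall>N\<in>T. \<forall>M\<in>T. N dvd M \<longrightarrow>
          (\<forall>r\<in>{0..<int N}. \<mu> N r = (\<Oplus>\<^bsub>Zlim S\<^esub>s\<in>{s \<in> {0..<int M}. s mod int N = r}. \<mu> M s))}"

text \<open>The map from \<open>Zhat[[Zhat]]\<close> to \<open>\<int>\<^sub>p[[\<int>\<^sub>p]]\<close>. The preimage in \<open>Zhat\<close> of a residue class
  mod \<open>p\<^sup>n\<close> of \<open>\<int>\<^sub>p\<close> is the same residue class mod \<open>p\<^sup>n\<close>, so pushing forward just keeps the levels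
  \<open>N = p\<^sup>n\<close>; likewise the projection of the coefficients keeps the components of index \<open>p\<^sup>n\<close>.\<close>

definition measure_image :: "nat \<Rightarrow> (nat \<Rightarrow> int \<Rightarrow> nat \<Rightarrow> int) \<Rightarrow> nat \<Rightarrow> int \<Rightarrow> nat \<Rightarrow> int" where
  "measure_image p \<mu> =
     (\<lambda>N\<in>Zp_index p. \<lambda>r\<in>{0..<int N}. restrict (\<mu> N r) (Zp_index p))"

text \<open>\<open>padic_integral p U f \<nu>\<close> is the integral over \<open>U \<subseteq> \<int>\<^sub>p\<close> of \<open>f : \<int>\<^sub>p \<rightarrow> \<int>\<^sub>p\<close> against
  \<open>\<nu> \<in> \<int>\<^sub>p[[\<int>\<^sub>p]]\<close>: the \<open>p\<close>-adic limit of the Riemann sums of \<open>f\<close> times the indicator function of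
  \<open>U\<close>, for the partitions of \<open>\<int>\<^sub>p\<close> into residue classes mod \<open>p\<^sup>j\<close>, where \<open>t r\<close> is an arbitrary
  sample point in the class of \<open>r\<close>. The limit exists whenever \<open>U\<close> is open and compact and \<open>f\<close> is
  continuous on \<open>U\<close>.\<close>

definition Riemann_sum ::
  "nat \<Rightarrow> (nat \<Rightarrow> int) set \<Rightarrow> ((nat \<Rightarrow> int) \<Rightarrow> (nat \<Rightarrow> int)) \<Rightarrow> (nat \<Rightarrow> int \<Rightarrow> nat \<Rightarrow> int) \<Rightarrow>
    nat \<Rightarrow> (int \<Rightarrow> nat \<Rightarrow> int) \<Rightarrow> nat \<Rightarrow> int" where
  "Riemann_sum p U f \<nu> j t =
     (\<Oplus>\<^bsub>Zp p\<^esub>r\<in>{r \<in> {0..<int (p ^ j)}. t r \<in> U}. f (t r) \<otimes>\<^bsub>Zp p\<^esub> \<nu> (p ^ j) r)"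

definition padic_integral ::
  "nat \<Rightarrow> (nat \<Rightarrow> int) set \<Rightarrow> ((nat \<Rightarrow> int) \<Rightarrow> (nat \<Rightarrow> int)) \<Rightarrow> (nat \<Rightarrow> int \<Rightarrow> nat \<Rightarrow> int) \<Rightarrow>
    nat \<Rightarrow> int" where
  "padic_integral p U f \<nu> =
     (THE I. I \<in> carrier (Zp p) \<and>
        (\<forall>n. \<exists>j\<^sub>0. \<forall>j\<ge>j\<^sub>0. \<forall>t. (\<forall>r\<in>{0..<int (p ^ j)}. t r \<in> carrier (Zp p) \<and> t r (p ^ j) = r) \<longrightarrow>
           Riemann_sum p U f \<nu> j t (p ^ n) = I (p ^ n)))"


section \<open>Bernoulli polynomials\<close>

text \<open>The value at \<open>T\<close> of the \<open>k\<close>-th Bernoulli polynomial.\<close>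

definition bernoulli_poly :: "nat \<Rightarrow> rat \<Rightarrow> rat" where
  "bernoulli_poly k T = fact k * fps_nth (fps_X * fps_exp T / (fps_exp 1 - 1)) k"

text \<open>Commonly written \<open>\<langle>a p\<inverse>\<rangle>\<close>; meaningful when \<open>p\<close> and \<open>m\<close> are coprime.\<close>

definition bracket_div :: "nat \<Rightarrow> nat \<Rightarrow> nat \<Rightarrow> nat" where
  "bracket_div m a p = (LEAST x. 0 < x \<and> [x * p = a] (mod m))"

end

theory Submission
  imports Defs
begin

text \<open>The automorphism \<open>\<sigma>\<close> raises roots of unity to the power of a unit \<open>c\<close> of the profinite integers with
  \<open>c \<equiv> 1\<close> modulo \<open>m\<close>. The first Bernoulli distribution \<open>E(s + M) = s/M - 1/2\<close> becomes integral after
  regularisation to \<open>E(s + M) - c E(c\<^sup>-\<^sup>1 s + M)\<close>, and \<open>\<zeta>\<close> is the restriction of this measure to the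
  residue class of \<open>a\<close> modulo \<open>m\<close>.

  If \<open>C t = s + M f\<close> with \<open>0 \<le> s, t < M\<close>, then \<open>s\<^sup>k \<equiv> (C t)\<^sup>k - k M s\<^sup>k\<^sup>-\<^sup>1 f\<close> modulo \<open>M\<^sup>2\<close>, so the \<open>(k-1)\<close>-st
  moment is the limit of \<open>(1 - C\<^sup>k)/(k M)\<close> times the sum of the \<open>k\<close>-th powers of the \<open>t < M\<close> prime to
  \<open>p\<close> with \<open>t \<equiv> a\<close> modulo \<open>m\<close>, and that power sum is \<open>M m\<^sup>k\<^sup>-\<^sup>1 B\<^sub>k(a/m)\<close> up to \<open>O(M\<^sup>2)\<close>. When \<open>p\<close> does not
  divide \<open>m\<close>, the multiples of \<open>p\<close> removed from the sum are \<open>p\<close> times the class of \<open>\<langle>a p\<^sup>-\<^sup>1\<rangle>\<close>, which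
  gives the second Bernoulli term.\<close>

section \<open>The rings \<open>Zlim S\<close>\<close>

lemma Zlim_index_simps:
  assumes "N \<in> S"
  shows "(x \<otimes>\<^bsub>Zlim S\<^esub> y) N = (x N * y N) mod int N"
    "(x \<oplus>\<^bsub>Zlim S\<^esub> y) N = (x N + y N) mod int N"
    "\<one>\<^bsub>Zlim S\<^esub> N = 1 mod int N" "\<zero>\<^bsub>Zlim S\<^esub> N = 0"
  using assms by (simp_all add: Zlim_def)

lemma Zlim_carrierI:
  assumes "0 \<notin> S"
    and "\<And>N M. N \<in> S \<Longrightarrow> M \<in> S \<Longrightarrow> N dvd M \<Longrightarrow> [f M = f N] (mod int N)"
  shows "(\<lambda>N\<in>S. f N mod int N) \<in> carrier (Zlim S)"
proof -
  have "f M mod int M mod int N = f N mod int N" if "N \<in> S" "M \<in> S" "N dvd M" for N M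
    using assms(2)[OF that] that(3) by (simp add: mod_mod_cancel cong_def)
  then show ?thesis
    using assms(1) by (auto simp: Zlim_def PiE_iff intro!: pos_mod_bound pos_mod_sign gr0I)
qed

lemma Zlim_carrierD:
  assumes "x \<in> carrier (Zlim S)"
  shows "N \<in> S \<Longrightarrow> M \<in> S \<Longrightarrow> N dvd M \<Longrightarrow> x M mod int N = x N"
    "N \<in> S \<Longrightarrow> 0 \<le> x N" "N \<in> S \<Longrightarrow> x N < int N" "x \<in> extensional S"
    "N \<in> S \<Longrightarrow> x N mod int N = x N"
  using assms by (auto simp: Zlim_def PiE_iff Pi_iff)

lemma Zlim_eqI:
  assumes "x \<in> carrier (Zlim S)" "y \<in> carrier (Zlim S)"
    and "\<And>N. N \<in> S \<Longrightarrow> [x N = y N] (mod int N)"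
  shows "x = y"
  using assms Zlim_carrierD[of x S] Zlim_carrierD[of y S]
  by (intro extensionalityI[of x S y]) (auto simp: cong_def)

lemma Zlim_restrict_carrier:
  assumes "x \<in> carrier (Zlim S)" "T \<subseteq> S"
  shows "restrict x T \<in> carrier (Zlim T)"
  using assms by (auto simp: Zlim_def PiE_iff subset_iff)

lemma Zlim_finsum_index:
  assumes "0 \<notin> S" "N \<in> S" "finite A" "\<And>x. x \<in> A \<Longrightarrow> f x \<in> carrier (Zlim S)"
  shows "(\<Oplus>\<^bsub>Zlim S\<^esub>x\<in>A. f x) N = (\<Sum>x\<in>A. f x N) mod int N"
proof -
  interpret cring "Zlim S" using assms(1) by (rule cring_Zlim)
  show ?thesis
    using assms(3,4)
  proof induction
    case (insert y A)
    then show ?case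
      using assms(2) by (subst finsum_insert) (auto simp: Zlim_index_simps mod_simps)
  qed (use assms(2) in \<open>simp add: Zlim_index_simps\<close>)
qed

lemma Zlim_pow_index:
  assumes "N \<in> S"
  shows "[(x [^]\<^bsub>Zlim S\<^esub> (k::nat)) N = x N ^ k] (mod int N)"
proof (induction k)
  case 0
  show ?case using assms by (simp add: nat_pow_def Zlim_index_simps cong_def)
next
  case (Suc k)
  have "[(x [^]\<^bsub>Zlim S\<^esub> k) N * x N = x N ^ k * x N] (mod int N)"
    using Suc by (rule cong_scalar_right)
  then show ?case
    using assms by (simp add: nat_pow_def Zlim_index_simps cong_def mult.commute)
qed

lemma Zlim_of_int_closed:
  assumes "0 \<notin> S"
  shows "Zlim_of_int S u \<in> carrier (Zlim S)"
  unfolding Zlim_of_int_def using assms by (intro Zlim_carrierI) auto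

lemma zero_notin_Zp_index: "Factorial_Ring.prime p \<Longrightarrow> 0 \<notin> Zp_index p"
  by (auto simp: Zp_index_def prime_gt_0_nat)

lemma power_in_Zp_index [simp]: "p ^ n \<in> Zp_index p"
  by (simp add: Zp_index_def)

lemma Zlim_of_int_neq_zero:
  assumes p: "Factorial_Ring.prime p" and v: "v \<noteq> 0"
  shows "Zlim_of_int (Zp_index p) v \<noteq> \<zero>\<^bsub>Zp p\<^esub>"
proof
  assume eq: "Zlim_of_int (Zp_index p) v = \<zero>\<^bsub>Zp p\<^esub>"
  \<comment> \<open>This level exceeds \<open>v\<close> in absolute value, so a nonzero
    \<open>v\<close> cannot vanish modulo it.\<close>
  let ?N = "p ^ nat \<bar>v\<bar>"
  have "v mod int ?N = 0"
    using fun_cong[OF eq, of ?N] by (simp add: Zlim_of_int_def Zlim_index_simps)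
  then have "int ?N \<le> \<bar>v\<bar>"
    using v dvd_imp_le_int[of v "int ?N"] by (simp add: dvd_eq_mod_eq_0)
  moreover have "nat \<bar>v\<bar> < ?N" using p by (intro power_gt_expt) (simp add: prime_gt_Suc_0_nat prime_gt_1_nat)
  ultimately show False by linarith
qed

text \<open>Being a unit is decided by the residue modulo \<open>p\<close>, which every level
  \<open>p ^ Suc n\<close> sees. Inverses modulo the levels fit together because an inverse modulo
  \<open>N\<close> is unique. The level is left free because a sample point of a Riemann sum is
  prescribed at one level only.\<close>

lemma Units_Zp_iff:
  assumes p: "Factorial_Ring.prime p" and x: "x \<in> carrier (Zp p)"
  shows "x \<in> Units (Zp p) \<longleftrightarrow> \<not> int p dvd x (p ^ Suc n)"
proof -
  note idx = power_in_Zp_index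
  have p1: "p > 1" using p by (rule prime_gt_1_nat)
  have all: "int p dvd x (p ^ Suc j) \<longleftrightarrow> int p dvd x p" for j
  proof -
    have "x (p ^ Suc j) mod int p = x p"
      using Zlim_carrierD(1)[OF x, of "p ^ 1" "p ^ Suc j"] idx[of p 1] idx[of p "Suc j"] by simp
    then show ?thesis by (metis dvd_mod_iff dvd_refl)
  qed
  interpret cring "Zp p" using zero_notin_Zp_index[OF p] by (rule cring_Zlim)
  have "\<not> int p dvd x p" if u: "x \<in> Units (Zp p)"
  proof
    assume d: "int p dvd x p"
    obtain y where "y \<in> carrier (Zp p)" "x \<otimes>\<^bsub>Zp p\<^esub> y = \<one>\<^bsub>Zp p\<^esub>"
      using u by (auto simp: Units_def)
    then have "(x p * y p) mod int p = 1 mod int p"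
      using idx[of p 1] by (metis Zlim_index_simps(1,3) power_one_right)
    with d have "1 mod int p = 0"
      by (metis dvd_mult2 dvd_imp_mod_0)
    with p1 show False by simp
  qed
  moreover have "x \<in> Units (Zp p)" if nd: "\<not> int p dvd x p"
  proof -
    have cop: "coprime (x (p ^ j)) (int (p ^ j))" for j
    proof (cases j)
      case (Suc i)
      have "coprime (x (p ^ Suc i)) (int p)"
        using all[of i] nd p by (metis coprime_commute prime_imp_coprime prime_nat_int_transfer)
      then show ?thesis using Suc by simp
    qed simp
    have "\<exists>y. [x N * y = 1] (mod int N)" if "N \<in> Zp_index p" for N
      using that cop by (auto simp: Zp_index_def intro: cong_solve_coprime_int)
    then obtain f where f: "\<And>N. N \<in> Zp_index p \<Longrightarrow> [x N * f N = 1] (mod int N)"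
      by metis
    let ?y = "\<lambda>N\<in>Zp_index p. f N mod int N"
    have y: "?y \<in> carrier (Zp p)"
    proof (rule Zlim_carrierI[OF zero_notin_Zp_index[OF p]])
      fix N M assume NM: "N \<in> Zp_index p" "M \<in> Zp_index p" "N dvd M"
      have c: "coprime (x N) (int N)" using NM(1) cop by (auto simp: Zp_index_def)
      have "[x N = x M] (mod int N)"
        using Zlim_carrierD(1)[OF x NM] Zlim_carrierD(5)[OF x NM(1)] by (simp add: cong_def)
      then have "[x N * f M = x M * f M] (mod int N)" by (rule cong_scalar_right)
      also have "[x M * f M = 1] (mod int N)"
        using f[OF NM(2)] NM(3) by (metis cong_dvd_modulus of_nat_dvd_iff)
      also have "[1 = x N * f N] (mod int N)" using f[OF NM(1)] by (rule cong_sym)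
      finally show "[f M = f N] (mod int N)" using c by (simp add: cong_mult_lcancel)
    qed
    moreover have "x \<otimes>\<^bsub>Zp p\<^esub> ?y = \<one>\<^bsub>Zp p\<^esub>"
    proof (rule Zlim_eqI)
      fix N assume N: "N \<in> Zp_index p"
      then show "[(x \<otimes>\<^bsub>Zp p\<^esub> ?y) N = \<one>\<^bsub>Zp p\<^esub> N] (mod int N)"
        using f[OF N] by (simp add: Zlim_index_simps cong_def mod_simps)
    qed (use x y in auto)
    ultimately show ?thesis
      using x m_comm[OF x y] by (auto simp: Units_def)
  qed
  ultimately show ?thesis using all[of n] by blast
qed

section \<open>Equations in the \<open>p\<close>-adic numbers\<close>

lemma (in domain) fraction_ring_hom: "(\<lambda>x. fraction R x \<one>) \<in> ring_hom R (Frac R)"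
proof (rule ring_hom_memI)
  show "fraction R \<one> \<one> = \<one>\<^bsub>Frac R\<^esub>" by (simp add: Frac_def)
qed (simp_all add: fraction_closed fraction_mult fraction_add)

text \<open>Writing \<open>q\<close> as \<open>u / v\<close> and cross-multiplying by
  \<open>v\<close>, which is nonzero in the domain \<open>Zp p\<close>, turns an equation of
  fractions into one in \<open>Zp p\<close>. That one can be checked modulo every
  \<open>p ^ n\<close> with ordinary integers.\<close>

lemma Qp_eqI:
  assumes p: "Factorial_Ring.prime p" and I: "I \<in> carrier (Zp p)" and x: "x \<in> carrier (Zp p)"
    and q: "quotient_of q = (u, v)"
    and eq: "\<And>n. [I (p ^ n) * v = (1 - x (p ^ n) ^ k) * u] (mod int (p ^ n))"
  shows "Qp_of_Zp p I = (\<one>\<^bsub>Qp p\<^esub> \<ominus>\<^bsub>Qp p\<^esub> Qp_of_Zp p x [^]\<^bsub>Qp p\<^esub> k) \<otimes>\<^bsub>Qp p\<^esub> Qp_of_rat p q"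
proof -
  have 0: "0 \<notin> Zp_index p" by (rule zero_notin_Zp_index[OF p])
  interpret Z: domain "Zp p" using p by (rule domain_Zp)
  interpret Q: field "Qp p" by (rule Z.field_Frac)
  have "Qp_of_Zp p \<in> ring_hom (Zp p) (Qp p)"
    using Z.fraction_ring_hom by (simp add: Qp_of_Zp_def[abs_def])
  then interpret h: ring_hom_cring "Zp p" "Qp p" "Qp_of_Zp p"
    by unfold_locales
  let ?U = "Zlim_of_int (Zp_index p) u" and ?V = "Zlim_of_int (Zp_index p) v"
  let ?Y = "\<one>\<^bsub>Zp p\<^esub> \<ominus>\<^bsub>Zp p\<^esub> x [^]\<^bsub>Zp p\<^esub> k"
  have U: "?U \<in> carrier (Zp p)" and V: "?V \<in> carrier (Zp p) - {\<zero>\<^bsub>Zp p\<^esub>}"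
    using Zlim_of_int_closed[OF 0] Zlim_of_int_neq_zero[OF p] quotient_of_denom_pos[OF q] by auto
  have Y: "?Y \<in> carrier (Zp p)" using x by simp
  have idx: "(I \<otimes>\<^bsub>Zp p\<^esub> ?V) (p ^ n) = (?Y \<otimes>\<^bsub>Zp p\<^esub> ?U) (p ^ n)" for n
  proof -
    \<comment> \<open>\<open>Zlim\<close> fixes sums componentwise but not negatives, so the
      components of the difference are read off from the sum that restores \<open>1\<close>.\<close>
    have "?Y \<oplus>\<^bsub>Zp p\<^esub> x [^]\<^bsub>Zp p\<^esub> k = \<one>\<^bsub>Zp p\<^esub>"
      using x by (simp add: Z.minus_eq Z.a_assoc Z.l_neg)
    then have "(?Y (p ^ n) + (x [^]\<^bsub>Zp p\<^esub> k) (p ^ n)) mod int (p ^ n) = 1 mod int (p ^ n)"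
      using Zlim_index_simps(2,3)[OF power_in_Zp_index[of p n]] by metis
    then have "[?Y (p ^ n) + (x [^]\<^bsub>Zp p\<^esub> k) (p ^ n) = 1] (mod int (p ^ n))"
      by (simp only: cong_def)
    from cong_diff[OF this Zlim_pow_index[OF power_in_Zp_index, where x = x and k = k]]
    have "[?Y (p ^ n) = 1 - x (p ^ n) ^ k] (mod int (p ^ n))"
      by simp
    then have "[?Y (p ^ n) * (u mod int (p ^ n)) = (1 - x (p ^ n) ^ k) * u] (mod int (p ^ n))"
      by (rule cong_mult) (simp only: cong_def mod_mod_trivial)
    moreover have "[I (p ^ n) * (v mod int (p ^ n)) = I (p ^ n) * v] (mod int (p ^ n))"
      by (rule cong_scalar_left) (simp only: cong_def mod_mod_trivial)
    ultimately have "[I (p ^ n) * (v mod int (p ^ n)) = ?Y (p ^ n) * (u mod int (p ^ n))] (mod int (p ^ n))"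
      using eq[of n] by (meson cong_sym cong_trans)
    then show ?thesis
      by (simp add: Zlim_index_simps Zlim_of_int_def cong_def)
  qed
  have "I \<otimes>\<^bsub>Zp p\<^esub> ?V = ?Y \<otimes>\<^bsub>Zp p\<^esub> ?U"
  proof (rule Zlim_eqI)
    fix N assume "N \<in> Zp_index p"
    then obtain n where "N = p ^ n" by (auto simp: Zp_index_def)
    then show "[(I \<otimes>\<^bsub>Zp p\<^esub> ?V) N = (?Y \<otimes>\<^bsub>Zp p\<^esub> ?U) N] (mod int N)"
      using idx[of n] by (simp only: cong_refl)
  qed (use I U V Y in auto)
  then have "Qp_of_Zp p I = fraction (Zp p) (?Y \<otimes>\<^bsub>Zp p\<^esub> ?U) ?V"
    unfolding Qp_of_Zp_def using I U V Y by (subst Z.fraction_eq_iff) auto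
  also have "\<dots> = Qp_of_Zp p ?Y \<otimes>\<^bsub>Qp p\<^esub> Qp_of_rat p q"
    unfolding Qp_of_Zp_def Qp_of_rat_def q using U V Y by (simp add: Z.fraction_mult)
  also have "Qp_of_Zp p ?Y = \<one>\<^bsub>Qp p\<^esub> \<ominus>\<^bsub>Qp p\<^esub> Qp_of_Zp p x [^]\<^bsub>Qp p\<^esub> k"
    using x by (simp add: Z.minus_eq Q.minus_eq h.hom_pow)
  finally show ?thesis .
qed

section \<open>Integrals of powers over the \<open>p\<close>-adic units\<close>

lemma measure_algebra_carrier:
  assumes "\<mu> \<in> measure_algebra S T" "N \<in> T" "r \<in> {0..<int N}"
  shows "\<mu> N r \<in> carrier (Zlim S)"
proof -
  have "\<mu> \<in> (\<Pi>\<^sub>E N\<in>T. {0..<int N} \<rightarrow>\<^sub>E carrier (Zlim S))"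
    using assms(1) unfolding measure_algebra_def mem_Collect_eq by (rule conjunct1)
  from PiE_mem[OF this assms(2)] show ?thesis
    by (rule PiE_mem) (rule assms(3))
qed

lemma measure_algebra_distribution:
  assumes "\<mu> \<in> measure_algebra S T" "N \<in> T" "M \<in> T" "N dvd M" "r \<in> {0..<int N}"
  shows "\<mu> N r = (\<Oplus>\<^bsub>Zlim S\<^esub>s\<in>{s \<in> {0..<int M}. s mod int N = r}. \<mu> M s)"
proof -
  have "\<forall>N\<in>T. \<forall>M\<in>T. N dvd M \<longrightarrow> (\<forall>r\<in>{0..<int N}.
      \<mu> N r = (\<Oplus>\<^bsub>Zlim S\<^esub>s\<in>{s \<in> {0..<int M}. s mod int N = r}. \<mu> M s))"
    using assms(1) unfolding measure_algebra_def mem_Collect_eq by (rule conjunct2)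
  then show ?thesis using assms(2-5) by (simp only: Ball_def)
qed

text \<open>Two refinements at once: the distribution relation splits the residue class, and
  compatibility in \<open>Zhat\<close> raises the coefficient. Everything is thereby expressed by
  the diagonal values at level \<open>p ^ j\<close>, the only ones that occur in
  \<open>unit_moment\<close>.\<close>

lemma measure_algebra_coefficient_cong:
  assumes \<nu>: "\<nu> \<in> measure_algebra Zhat_index Zhat_index" and p: "Factorial_Ring.prime p"
    and "n \<le> j" "l \<le> j" "r \<in> {0..<int (p ^ n)}"
  shows "[\<nu> (p ^ n) r (p ^ l) = (\<Sum>s\<in>{s \<in> {0..<int (p ^ j)}. s mod int (p ^ n) = r}. \<nu> (p ^ j) s (p ^ j))] (mod int (p ^ l))"
proof -
  have p0: "p > 0" using p by (rule prime_gt_0_nat)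
  have idx: "p ^ i \<in> Zhat_index" for i using p0 by (simp add: Zhat_index_def)
  have dvd: "p ^ n dvd p ^ j" "p ^ l dvd p ^ j" using assms by (auto simp: le_imp_power_dvd)
  let ?T = "{s \<in> {0..<int (p ^ j)}. s mod int (p ^ n) = r}"
  have fin: "finite ?T" by (rule finite_subset[of _ "{0..<int (p ^ j)}"]) auto
  have car: "\<nu> (p ^ j) s \<in> carrier Zhat" if "s \<in> ?T" for s
    using that by (intro measure_algebra_carrier[OF \<nu> idx]) simp
  have eq: "\<nu> (p ^ n) r = (\<Oplus>\<^bsub>Zhat\<^esub>s\<in>?T. \<nu> (p ^ j) s)"
    by (rule measure_algebra_distribution[OF \<nu> idx idx dvd(1) assms(5)])
  have "\<nu> (p ^ n) r (p ^ l) = (\<Sum>s\<in>?T. \<nu> (p ^ j) s (p ^ l)) mod int (p ^ l)"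
    unfolding eq by (rule Zlim_finsum_index[OF _ idx fin car]) (simp_all only: Zhat_index_def greaterThan_iff less_irrefl not_False_eq_True)
  moreover have "[(\<Sum>s\<in>?T. \<nu> (p ^ j) s (p ^ l)) = (\<Sum>s\<in>?T. \<nu> (p ^ j) s (p ^ j))] (mod int (p ^ l))"
  proof (rule cong_sum)
    fix s assume s: "s \<in> ?T"
    show "[\<nu> (p ^ j) s (p ^ l) = \<nu> (p ^ j) s (p ^ j)] (mod int (p ^ l))"
      using Zlim_carrierD(1)[OF car[OF s] idx idx dvd(2)] Zlim_carrierD(5)[OF car[OF s] idx[of l]]
      by (simp add: cong_def)
  qed
  ultimately show ?thesis by (simp add: cong_def)
qed

text \<open>The Riemann sum of \<open>x\<^sup>k\<close> over the units at level \<open>p\<^sup>j\<close>, with sample points in \<open>{0..<p\<^sup>j}\<close>; the limit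
  stabilises modulo \<open>p\<^sup>n\<close> from level \<open>n\<close> on.\<close>

definition unit_moment :: "nat \<Rightarrow> (nat \<Rightarrow> int \<Rightarrow> nat \<Rightarrow> int) \<Rightarrow> nat \<Rightarrow> nat \<Rightarrow> int" where
  "unit_moment p \<nu> k j = (\<Sum>r\<in>{r \<in> {0..<int (p ^ j)}. \<not> int p dvd r}. r ^ k * \<nu> (p ^ j) r (p ^ j))"

text \<open>Residues modulo \<open>p ^ j\<close> are grouped by their residue \<open>r\<close>
  modulo \<open>p ^ n\<close>: on each group the powers agree with \<open>r ^ k\<close>, and the
  coefficients add up to the coarser one. For \<open>0 < n\<close>, divisibility by \<open>p\<close>
  depends on \<open>r\<close> alone.\<close>

lemma unit_moment_stable:
  assumes \<nu>: "\<nu> \<in> measure_algebra Zhat_index Zhat_index" and p: "Factorial_Ring.prime p"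
    and "n \<le> j" "0 < n"
  shows "[unit_moment p \<nu> k j = unit_moment p \<nu> k n] (mod int (p ^ n))"
proof -
  let ?U = "\<lambda>j. {r \<in> {0..<int (p ^ j)}. \<not> int p dvd r}"
  let ?g = "\<lambda>s. s mod int (p ^ n)"
  have fin: "finite (?U j)" for j by (rule finite_subset[of _ "{0..<int (p ^ j)}"]) auto
  have p0: "int (p ^ n) > 0" using p by (simp add: prime_gt_0_nat)
  have pd: "int p dvd ?g s \<longleftrightarrow> int p dvd s" for s
    using assms(4) by (intro dvd_mod_iff) (auto intro: dvd_power)
  define F where "F l s = s ^ k * \<nu> (p ^ l) s (p ^ l)" for l s
  let ?V = "\<lambda>r. {s \<in> ?U j. ?g s = r}"
  have um: "unit_moment p \<nu> k l = sum (F l) (?U l)" for l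
    by (simp add: unit_moment_def F_def)
  have g: "?g s \<in> {0..<int (p ^ n)}" for s
    using p0 by (simp only: atLeastLessThan_iff pos_mod_sign pos_mod_bound simp_thms)
  have "?g ` ?U j \<subseteq> ?U n"
    by (intro image_subsetI CollectI conjI g) (simp only: pd mem_Collect_eq simp_thms)
  then have "sum (F j) (?U j) = sum (\<lambda>r. sum (F j) (?V r)) (?U n)"
    by (rule sum.group[OF fin fin, symmetric])
  moreover have "[sum (\<lambda>r. sum (F j) (?V r)) (?U n) = sum (F n) (?U n)] (mod int (p ^ n))"
  proof (rule cong_sum)
    fix r assume r: "r \<in> ?U n"
    have eq: "?V r = {s \<in> {0..<int (p ^ j)}. ?g s = r}"
      using r pd by blast
    have "[sum (F j) (?V r) = sum (\<lambda>s. r ^ k * \<nu> (p ^ j) s (p ^ j)) (?V r)] (mod int (p ^ n))"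
      unfolding F_def by (intro cong_sum cong_mult cong_pow cong_refl) (auto simp: cong_def)
    moreover have "sum (\<lambda>s. r ^ k * \<nu> (p ^ j) s (p ^ j)) (?V r) = r ^ k * sum (\<lambda>s. \<nu> (p ^ j) s (p ^ j)) (?V r)"
      by (simp only: sum_distrib_left)
    moreover have "[r ^ k * \<nu> (p ^ n) r (p ^ n) = r ^ k * sum (\<lambda>s. \<nu> (p ^ j) s (p ^ j)) (?V r)] (mod int (p ^ n))"
      unfolding eq by (rule cong_scalar_left, rule measure_algebra_coefficient_cong[OF \<nu> p assms(3,3)]) (use r in simp)
    ultimately show "[sum (F j) (?V r) = F n r] (mod int (p ^ n))"
      unfolding F_def by (simp add: cong_def)
  qed
  ultimately show ?thesis by (simp only: um)
qed

text \<open>The choice of sample points does not matter: \<open>t r\<close> is congruent to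
  \<open>r\<close> modulo \<open>p ^ j\<close>, which fixes its powers modulo \<open>p ^ n\<close>
  and, as \<open>0 < j\<close>, also decides whether it is a unit.\<close>

lemma Riemann_sum_cong_unit_moment:
  assumes \<nu>: "\<nu> \<in> measure_algebra Zhat_index Zhat_index" and p: "Factorial_Ring.prime p"
    and "n \<le> j" "0 < j"
    and t: "\<And>r. r \<in> {0..<int (p ^ j)} \<Longrightarrow> t r \<in> carrier (Zp p) \<and> t r (p ^ j) = r"
  shows "Riemann_sum p (Units (Zp p)) (\<lambda>b. b [^]\<^bsub>Zp p\<^esub> k) (measure_image p \<nu>) j t (p ^ n)
    = unit_moment p \<nu> k j mod int (p ^ n)"
proof -
  have p0: "p > 0" using p by (rule prime_gt_0_nat)
  have idx: "p ^ i \<in> Zhat_index" for i using p0 by (simp add: Zhat_index_def)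
  have sub: "Zp_index p \<subseteq> Zhat_index" using idx by (auto simp: Zp_index_def)
  let ?U = "{r \<in> {0..<int (p ^ j)}. \<not> int p dvd r}"
  have fin: "finite ?U" by (rule finite_subset[of _ "{0..<int (p ^ j)}"]) auto
  obtain i where i: "j = Suc i" using assms(4) by (cases j) auto
  have U: "{r \<in> {0..<int (p ^ j)}. t r \<in> Units (Zp p)} = ?U"
    using t Units_Zp_iff[OF p, of _ i] unfolding i by fastforce
  interpret cring "Zp p" using zero_notin_Zp_index[OF p] by (rule cring_Zlim)
  have mi: "measure_image p \<nu> (p ^ j) r = restrict (\<nu> (p ^ j) r) (Zp_index p)" if "r \<in> ?U" for r
    using that by (simp add: measure_image_def)
  have \<nu>car: "\<nu> (p ^ j) r \<in> carrier Zhat" if "r \<in> ?U" for r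
    using that by (intro measure_algebra_carrier[OF \<nu> idx]) simp
  have car: "restrict (\<nu> (p ^ j) r) (Zp_index p) \<in> carrier (Zp p)" if "r \<in> ?U" for r
    by (rule Zlim_restrict_carrier[OF \<nu>car[OF that] sub])
  define G where "G r = t r [^]\<^bsub>Zp p\<^esub> k \<otimes>\<^bsub>Zp p\<^esub> restrict (\<nu> (p ^ j) r) (Zp_index p)" for r
  define F where "F r = r ^ k * \<nu> (p ^ j) r (p ^ j)" for r
  have Gcar: "G r \<in> carrier (Zp p)" if "r \<in> ?U" for r
    using car[OF that] t[of r] that by (simp add: G_def)
  have "Riemann_sum p (Units (Zp p)) (\<lambda>b. b [^]\<^bsub>Zp p\<^esub> k) (measure_image p \<nu>) j t = finsum (Zp p) G ?U"
    unfolding Riemann_sum_def U using Gcar mi by (intro finsum_cong') (auto simp: G_def)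
  then have "Riemann_sum p (Units (Zp p)) (\<lambda>b. b [^]\<^bsub>Zp p\<^esub> k) (measure_image p \<nu>) j t (p ^ n) = finsum (Zp p) G ?U (p ^ n)"
    by (simp only:)
  moreover have "finsum (Zp p) G ?U (p ^ n) = sum (\<lambda>r. G r (p ^ n)) ?U mod int (p ^ n)"
    using fin Gcar by (intro Zlim_finsum_index zero_notin_Zp_index[OF p]) auto
  moreover have "[sum (\<lambda>r. G r (p ^ n)) ?U = sum F ?U] (mod int (p ^ n))"
  proof (rule cong_sum)
    fix r assume r: "r \<in> ?U"
    have dvd: "p ^ n dvd p ^ j" using assms by (simp add: le_imp_power_dvd)
    have 1: "[(t r [^]\<^bsub>Zp p\<^esub> k) (p ^ n) = t r (p ^ n) ^ k] (mod int (p ^ n))"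
      by (intro Zlim_pow_index) simp
    have "t r (p ^ n) = r mod int (p ^ n)"
      using Zlim_carrierD(1)[of "t r" "Zp_index p" "p ^ n" "p ^ j"] t[of r] r dvd by simp
    then have 2: "[t r (p ^ n) ^ k = r ^ k] (mod int (p ^ n))"
      by (intro cong_pow) simp
    have 3: "[\<nu> (p ^ j) r (p ^ n) = \<nu> (p ^ j) r (p ^ j)] (mod int (p ^ n))"
      using Zlim_carrierD(1)[OF \<nu>car[OF r] idx idx dvd] Zlim_carrierD(5)[OF \<nu>car[OF r] idx[of n]]
      by (simp add: cong_def)
    have "[(t r [^]\<^bsub>Zp p\<^esub> k) (p ^ n) * \<nu> (p ^ j) r (p ^ n) = F r] (mod int (p ^ n))"
      unfolding F_def by (rule cong_mult[OF cong_trans[OF 1 2] 3])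
    then show "[G r (p ^ n) = F r] (mod int (p ^ n))"
      by (simp add: G_def Zlim_index_simps cong_def)
  qed
  then have "sum (\<lambda>r. G r (p ^ n)) ?U mod int (p ^ n) = unit_moment p \<nu> k j mod int (p ^ n)"
    unfolding cong_def unit_moment_def F_def .
  ultimately show ?thesis by (simp only:)
qed

text \<open>The description operator in the integral calls for existence and uniqueness. The stable
  values of the unit moments form an element \<open>J\<close> of \<open>Zp p\<close>, and the
  Riemann sums leave no other candidate.\<close>

lemma padic_integral_power_Units:
  fixes k :: nat
  assumes \<nu>: "\<nu> \<in> measure_algebra Zhat_index Zhat_index" and p: "Factorial_Ring.prime p"
  defines "I \<equiv> padic_integral p (Units (Zp p)) (\<lambda>b. b [^]\<^bsub>Zp p\<^esub> (k::nat)) (measure_image p \<nu>)"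
  shows "I \<in> carrier (Zp p)"
    and "n \<le> j \<Longrightarrow> 0 < j \<Longrightarrow> [I (p ^ n) = unit_moment p \<nu> k j] (mod int (p ^ n))"
proof -
  let ?R = "\<lambda>j t. Riemann_sum p (Units (Zp p)) (\<lambda>b. b [^]\<^bsub>Zp p\<^esub> k) (measure_image p \<nu>) j t"
  let ?tag = "\<lambda>j t. \<forall>r\<in>{0..<int (p ^ j)}. t r \<in> carrier (Zp p) \<and> t r (p ^ j) = r"
  let ?P = "\<lambda>I. I \<in> carrier (Zp p) \<and>
    (\<forall>n. \<exists>j\<^sub>0. \<forall>j\<ge>j\<^sub>0. \<forall>t. ?tag j t \<longrightarrow> ?R j t (p ^ n) = I (p ^ n))"
  have p1: "p > 1" using p by (rule prime_gt_1_nat)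
  have stable: "[unit_moment p \<nu> k j = unit_moment p \<nu> k i] (mod int (p ^ n))"
    if "n \<le> i" "n \<le> j" "0 < i" "0 < j" for n i j
  proof (cases n)
    case 0
    then show ?thesis by (simp add: cong_def)
  next
    case (Suc n')
    then have n: "0 < n" by simp
    show ?thesis
      using unit_moment_stable[OF \<nu> p that(1) n] unit_moment_stable[OF \<nu> p that(2) n]
      by (meson cong_sym cong_trans)
  qed
  define e where "e N = (THE n. N = p ^ n)" for N
  have e: "e (p ^ n) = n" for n
    unfolding e_def using p1 by (intro the_equality) auto
  \<comment> \<open>The shift by \<open>Suc\<close> keeps the level positive, as
    \<open>stable\<close> demands, even for the component at \<open>p ^ 0\<close>.\<close>
  define J where "J = (\<lambda>N\<in>Zp_index p. unit_moment p \<nu> k (Suc (e N)) mod int N)"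
  have J: "J (p ^ n) = unit_moment p \<nu> k (Suc n) mod int (p ^ n)" for n
    by (simp add: J_def e)
  have Jcar: "J \<in> carrier (Zp p)"
    unfolding J_def
  proof (rule Zlim_carrierI[OF zero_notin_Zp_index[OF p]])
    fix N M assume "N \<in> Zp_index p" "M \<in> Zp_index p" "N dvd M"
    then obtain n l where nl: "N = p ^ n" "M = p ^ l" "p ^ n dvd p ^ l"
      by (auto simp: Zp_index_def)
    then have "n \<le> l" using p1 by (simp add: power_dvd_imp_le)
    then show "[unit_moment p \<nu> k (Suc (e M)) = unit_moment p \<nu> k (Suc (e N))] (mod int N)"
      unfolding nl(1,2) e by (intro stable) auto
  qed
  have R: "?R j t (p ^ n) = J (p ^ n)" if j: "Suc n \<le> j" and t: "?tag j t" for n j t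
  proof -
    have "?R j t (p ^ n) = unit_moment p \<nu> k j mod int (p ^ n)"
      by (rule Riemann_sum_cong_unit_moment[OF \<nu> p _ _ bspec[OF t]]) (use j in auto)
    also have "\<dots> = J (p ^ n)"
      unfolding J using j by (intro stable[unfolded cong_def]) auto
    finally show ?thesis .
  qed
  have PJ: "?P J"
    using Jcar R by (intro conjI allI) (assumption, rule_tac x = "Suc n" in exI, blast)
  \<comment> \<open>Without admissible sample points the limit condition would hold vacuously, so
    uniqueness needs some at every level; the integers \<open>r\<close> themselves serve.\<close>
  have tags: "\<exists>t. ?tag j t" for j
  proof (intro exI[of _ "\<lambda>r. Zlim_of_int (Zp_index p) r"] ballI conjI)
    fix r assume "r \<in> {0..<int (p ^ j)}"
    then show "Zlim_of_int (Zp_index p) r (p ^ j) = r" by (simp add: Zlim_of_int_def)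
    show "Zlim_of_int (Zp_index p) r \<in> carrier (Zp p)"
      unfolding Zlim_of_int_def by (intro Zlim_carrierI zero_notin_Zp_index[OF p]) auto
  qed
  have uniq: "x = J" if x: "?P x" for x
  proof (rule Zlim_eqI[of _ "Zp_index p"])
    fix N assume "N \<in> Zp_index p"
    then obtain n where N: "N = p ^ n" by (auto simp: Zp_index_def)
    obtain j0 where j0: "\<And>j t. j \<ge> j0 \<Longrightarrow> ?tag j t \<Longrightarrow> ?R j t (p ^ n) = x (p ^ n)"
      using x by meson
    let ?j = "max j0 (Suc n)"
    obtain t where t: "?tag ?j t" using tags by blast
    have "x (p ^ n) = ?R ?j t (p ^ n)"
      by (rule j0[OF max.cobounded1 t, symmetric])
    also have "\<dots> = J (p ^ n)"
      by (rule R[OF max.cobounded2 t])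
    finally have "x (p ^ n) = J (p ^ n)" .
    then show "[x N = J N] (mod int N)" by (simp add: N)
  qed (use x Jcar in auto)
  have IJ: "I = J"
    unfolding I_def padic_integral_def by (rule the_equality, rule PJ, rule uniq)
  then show "I \<in> carrier (Zp p)" using Jcar by simp
  assume "n \<le> j" "0 < j"
  then show "[I (p ^ n) = unit_moment p \<nu> k j] (mod int (p ^ n))"
    using stable[of n "Suc n" j] unfolding IJ J cong_def by simp
qed

section \<open>The Galois action on roots of unity\<close>

definition unity_root :: "nat \<Rightarrow> complex" where
  "unity_root N = cis (2 * pi / real N)"

lemma unity_root_power: "unity_root N ^ k = cis (2 * pi * real k / real N)"
  by (simp add: unity_root_def DeMoivre mult_ac)

lemma unity_root_order: "N > 0 \<Longrightarrow> unity_root N ^ N = 1"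
  by (simp add: unity_root_power)

lemma unity_root_power_mod:
  assumes "N > 0"
  shows "unity_root N ^ (i mod N) = unity_root N ^ i"
proof -
  have "unity_root N ^ i = unity_root N ^ (N * (i div N) + i mod N)" by simp
  also have "\<dots> = unity_root N ^ (i mod N)"
    by (simp only: power_add power_mult unity_root_order[OF assms] power_one mult_1)
  finally show ?thesis by simp
qed

lemma unity_root_power_eq_iff:
  assumes "N > 0"
  shows "unity_root N ^ i = unity_root N ^ j \<longleftrightarrow> [i = j] (mod N)"
proof
  assume "unity_root N ^ i = unity_root N ^ j"
  then have "unity_root N ^ (i mod N) = unity_root N ^ (j mod N)"
    by (simp only: unity_root_power_mod[OF assms])
  moreover have "inj_on (\<lambda>k. cis (2 * pi * real k / real N)) {..<N}"
    using bij_betw_roots_unity[OF assms] by (rule bij_betw_imp_inj_on)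
  ultimately show "[i = j] (mod N)"
    unfolding cong_def unity_root_power using assms by (auto dest: inj_onD)
next
  assume "[i = j] (mod N)"
  then show "unity_root N ^ i = unity_root N ^ j"
    by (metis assms cong_def unity_root_power_mod)
qed

lemma roots_of_unity_eq_power:
  assumes "N > 0" "z ^ N = 1"
  obtains i where "i < N" "z = unity_root N ^ i"
proof -
  have "z \<in> (\<lambda>k. cis (2 * pi * real k / real N)) ` {..<N}"
    using bij_betw_roots_unity[OF assms(1)] assms(2) by (auto simp: bij_betw_def)
  then show ?thesis using that by (auto simp: unity_root_power)
qed

lemma CC_simps [simp]:
  "carrier CC = UNIV" "x \<otimes>\<^bsub>CC\<^esub> y = x * y" "\<one>\<^bsub>CC\<^esub> = 1" "\<zero>\<^bsub>CC\<^esub> = 0" "x \<oplus>\<^bsub>CC\<^esub> y = x + y"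
  by (simp_all add: ring_of_type_algebra_def)

lemma CC_a_inv: "\<ominus>\<^bsub>CC\<^esub> x = - x"
proof -
  interpret field CC by (rule field_from_type_algebra)
  show ?thesis using minus_equality[of "- x" x] by simp
qed

lemma cyclotomic_field_zero_one_minus_one:
  "0 \<in> cyclotomic_field m" "1 \<in> cyclotomic_field m" "- 1 \<in> cyclotomic_field m"
proof -
  show 1: "1 \<in> cyclotomic_field m"
    using generate_field.one[of CC] by (simp add: cyclotomic_field_def)
  show 2: "- 1 \<in> cyclotomic_field m"
    using generate_field.a_inv[of 1 CC] 1 by (simp add: cyclotomic_field_def CC_a_inv)
  show "0 \<in> cyclotomic_field m"
    using generate_field.eng_add[of 1 CC _ "- 1"] 1 2 by (simp add: cyclotomic_field_def)
qed

text \<open>The automorphisms are multiplicative and injective only on the algebraic closure, so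
  roots of unity have to be located there. The witness is the polynomial \<open>X ^ N - 1\<close>,
  with coefficients among 0, 1 and -1.\<close>

lemma root_of_unity_algebraic:
  assumes "N > 0" "z ^ N = 1"
  shows "z \<in> alg_closure_in_complex (cyclotomic_field m)"
proof -
  let ?q = "Polynomial.monom 1 N - 1 :: complex poly"
  have "Polynomial.coeff ?q i \<in> cyclotomic_field m" for i
    using assms(1) by (cases "i = 0") (auto simp: cyclotomic_field_zero_one_minus_one)
  moreover have "?q \<noteq> 0"
  proof
    assume "?q = 0"
    then have "Polynomial.coeff ?q N = 0" by (simp only: coeff_0)
    then show False using assms(1) by (simp add: coeff_eq_0)
  qed
  moreover have "poly ?q z = 0" using assms(2) by (simp add: poly_monom)
  ultimately show ?thesis unfolding alg_closure_in_complex_def by blast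
qed

text \<open>The exponents at the levels \<open>N\<close> form a profinite integer because an
  \<open>N\<close>-th root of unity is also an \<open>M\<close>-th root when \<open>N\<close>
  divides \<open>M\<close>. Injectivity of \<sigma> makes them units, and
  \<open>unity_root m\<close>, which lies in the fixed field, forces 1 modulo
  \<open>m\<close>.\<close>

lemma Galois_acts_on_roots_of_unity:
  assumes \<sigma>: "\<sigma> \<in> absolute_Galois_group (cyclotomic_field m)" and m: "m > 0"
  obtains c where "c \<in> carrier Zhat" "\<And>N. N > 0 \<Longrightarrow> coprime (c N) (int N)" "[c m = 1] (mod int m)"
    "\<And>N z. N > 0 \<Longrightarrow> z ^ N = 1 \<Longrightarrow> \<sigma> z = z ^ nat (c N)"
proof -
  let ?K = "alg_closure_in_complex (cyclotomic_field m)"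
  have iso: "\<sigma> \<in> ring_iso (CC\<lparr>carrier := ?K\<rparr>) (CC\<lparr>carrier := ?K\<rparr>)"
    and fix_F: "\<And>x. x \<in> cyclotomic_field m \<Longrightarrow> \<sigma> x = x"
    using \<sigma> by (auto simp: absolute_Galois_group_def)
  have \<sigma>mult: "\<sigma> (x * y) = \<sigma> x * \<sigma> y" if "x \<in> ?K" "y \<in> ?K" for x y
    using ring_iso_memE(2)[OF iso, of x y] that by simp
  have \<sigma>1: "\<sigma> 1 = 1" using ring_iso_memE(4)[OF iso] by simp
  have inj: "inj_on \<sigma> ?K" using ring_iso_memE(5)[OF iso] by (simp add: bij_betw_def)
  have \<sigma>pow: "\<sigma> (z ^ i) = \<sigma> z ^ i" if z: "N > 0" "z ^ N = 1" for z i N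
  proof (induction i)
    case (Suc i)
    have "(z ^ i) ^ N = 1" using z by (metis power_mult mult.commute power_one)
    then have "\<sigma> (z * z ^ i) = \<sigma> z * \<sigma> (z ^ i)"
      using z by (intro \<sigma>mult root_of_unity_algebraic)
    then show ?case using Suc by simp
  qed (simp add: \<sigma>1)
  have "\<exists>k<N. \<sigma> (unity_root N) = unity_root N ^ k" if N: "N > 0" for N
  proof -
    have "\<sigma> (unity_root N) ^ N = 1"
      using \<sigma>pow[OF N unity_root_order[OF N], of N] by (simp add: unity_root_order N \<sigma>1)
    then show ?thesis using roots_of_unity_eq_power[OF N] by metis
  qed
  then obtain e where e: "\<And>N. N > 0 \<Longrightarrow> e N < N" "\<And>N. N > 0 \<Longrightarrow> \<sigma> (unity_root N) = unity_root N ^ e N"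
    by metis
  have act: "\<sigma> z = z ^ e N" if z: "N > 0" "z ^ N = 1" for N z
  proof -
    obtain i where "z = unity_root N ^ i" using roots_of_unity_eq_power[OF z] by metis
    then show ?thesis
      using \<sigma>pow[OF z(1) unity_root_order[OF z(1)], of i] e(2)[OF z(1)]
      by (metis mult.commute power_mult)
  qed
  have compat: "[e M = e N] (mod N)" if dvd: "N dvd M" and M: "M > 0" for N M
  proof -
    obtain d where d: "M = N * d" using dvd by blast
    have pos: "N > 0" "d > 0" using M d by auto
    have "unity_root N ^ M = 1"
      using unity_root_order[OF pos(1)] by (simp add: d power_mult)
    then have "unity_root N ^ e M = unity_root N ^ e N"
      using act[OF M] e(2)[OF pos(1)] by metis
    then show ?thesis using unity_root_power_eq_iff[OF pos(1)] by simp
  qed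
  have cop: "coprime (e N) N" if N: "N > 0" for N
  proof -
    \<comment> \<open>With \<open>N = ?g * b\<close>, the power \<open>unity_root N ^ b\<close> is
      sent to 1 and hence equals 1 by injectivity. So \<open>N\<close> divides \<open>b\<close>,
      which forces \<open>?g = 1\<close>.\<close>
    let ?g = "gcd (e N) N"
    obtain b where b: "N = ?g * b" by (metis dvdE gcd_dvd2)
    have "N dvd b * e N"
      using b by (metis gcd_dvd1 mult.commute mult_dvd_mono dvd_refl)
    then have "[b * e N = 0] (mod N)" by (simp add: cong_0_iff)
    then have "unity_root N ^ (b * e N) = 1"
      using unity_root_power_eq_iff[OF N, of _ 0] by simp
    moreover have "\<sigma> (unity_root N ^ b) = unity_root N ^ (b * e N)"
      using \<sigma>pow[OF N unity_root_order[OF N], of b] e(2)[OF N] by (metis mult.commute power_mult)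
    ultimately have "\<sigma> (unity_root N ^ b) = \<sigma> 1" by (simp add: \<sigma>1)
    moreover have "(unity_root N ^ b) ^ N = 1"
      using unity_root_order[OF N] by (metis mult.commute power_mult power_one)
    then have "unity_root N ^ b \<in> ?K" "1 \<in> ?K"
      using N by (auto intro!: root_of_unity_algebraic[OF N])
    ultimately have "unity_root N ^ b = unity_root N ^ 0"
      using inj by (simp add: inj_on_def)
    then have "N dvd b"
      unfolding unity_root_power_eq_iff[OF N] by (simp add: cong_0_iff)
    moreover have "b > 0" using b N by (cases b) auto
    ultimately have "?g * b \<le> b" using b by (metis dvd_imp_le)
    then have "?g \<le> 1" using \<open>b > 0\<close> by simp
    moreover have "?g > 0" using N by simp
    ultimately have "?g = 1" by linarith
    then show ?thesis by (simp only: coprime_iff_gcd_eq_1)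
  qed
  have em: "[e m = 1] (mod m)"
  proof -
    have "unity_root m \<in> roots_of_unity m" by (simp add: roots_of_unity_def unity_root_order m)
    then have "unity_root m \<in> cyclotomic_field m"
      unfolding cyclotomic_field_def by (rule generate_field.incl)
    then have "unity_root m ^ e m = unity_root m ^ 1" using fix_F e(2)[OF m] by simp
    then show ?thesis using unity_root_power_eq_iff[OF m] by blast
  qed
  let ?c = "\<lambda>N\<in>Zhat_index. int (e N) mod int N"
  have c: "?c N = int (e N)" if "N > 0" for N
    using that e(1)[OF that] by (simp add: Zhat_index_def)
  show ?thesis
  proof
    show "?c \<in> carrier Zhat"
      by (rule Zlim_carrierI) (auto simp: Zhat_index_def cong_int_iff compat)
    show "coprime (?c N) (int N)" if "N > 0" for N
      using cop[OF that] by (simp only: c[OF that] coprime_int_iff)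
    show "[?c m = 1] (mod int m)"
      using em unfolding c[OF m] by (metis cong_int_iff of_nat_1)
    show "\<sigma> z = z ^ nat (?c N)" if "N > 0" "z ^ N = 1" for N z
      unfolding c[OF that(1)] using act[OF that] by simp
  qed
qed

text \<open>The primitive root \<open>unity_root (p ^ n)\<close> determines its exponent modulo
  \<open>p ^ n\<close>, which gives uniqueness. All the characters are therefore projections of the
  one profinite exponent \<open>c\<close>.\<close>

lemma cyclotomic_character_eq_restrict:
  assumes c: "c \<in> carrier Zhat" and act: "\<And>N z. N > 0 \<Longrightarrow> z ^ N = 1 \<Longrightarrow> \<sigma> z = z ^ nat (c N)"
    and p: "p > 0"
  shows "cyclotomic_character p \<sigma> = restrict c (Zp_index p)"
  unfolding cyclotomic_character_def
proof (rule the_equality)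
  have sub: "Zp_index p \<subseteq> Zhat_index" using p by (auto simp: Zp_index_def Zhat_index_def)
  have car: "restrict c (Zp_index p) \<in> carrier (Zp p)"
    by (rule Zlim_restrict_carrier[OF c sub])
  then show "restrict c (Zp_index p) \<in> carrier (Zp p) \<and>
     (\<forall>n. \<forall>\<zeta>\<in>roots_of_unity (p ^ n). \<sigma> \<zeta> = \<zeta> ^ nat (restrict c (Zp_index p) (p ^ n)))"
    using act p by (auto simp: roots_of_unity_def Zp_index_def)
  fix x assume x: "x \<in> carrier (Zp p) \<and> (\<forall>n. \<forall>\<zeta>\<in>roots_of_unity (p ^ n). \<sigma> \<zeta> = \<zeta> ^ nat (x (p ^ n)))"
  show "x = restrict c (Zp_index p)"
  proof (rule Zlim_eqI[OF _ car])
    fix N assume N: "N \<in> Zp_index p"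
    then obtain n where n: "N = p ^ n" by (auto simp: Zp_index_def)
    have pos: "N > 0" using p n by simp
    have nn: "0 \<le> x N" "0 \<le> c N"
      using x N sub c by (auto intro: Zlim_carrierD(2))
    have u: "unity_root N ^ N = 1" using pos by (rule unity_root_order)
    then have "\<sigma> (unity_root N) = unity_root N ^ nat (x N)"
      using x n by (auto simp: roots_of_unity_def)
    then have "[nat (x N) = nat (c N)] (mod N)"
      using act[OF pos u] unity_root_power_eq_iff[OF pos] by metis
    then have "[int (nat (x N)) = int (nat (c N))] (mod int N)" by (simp only: cong_int_iff)
    then show "[x N = restrict c (Zp_index p) N] (mod int N)"
      using nn N by simp
  qed (use x in simp)
qed

section \<open>The measure\<close>

text \<open>The distribution relation of the first Bernoulli polynomial in integral form. As
  \<open>C\<close> is prime to \<open>q\<close>, the remainders of \<open>y + C * h\<close> run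
  through all residues, so the sum of the quotients follows from the sums of dividends and
  remainders. Oddness of \<open>C\<close> makes the halving exact.\<close>

lemma sum_progression_div:
  fixes y C q :: int
  assumes "q > 0" "coprime C q" "odd C"
  shows "(\<Sum>h\<in>{0..<q}. (C - 1) div 2 - (y + C * h) div q) = (C - 1) div 2 - y"
proof -
  have gauss: "2 * (\<Sum>h\<in>{0..<q}. h) = q * (q - 1)"
  proof -
    have "2 * (\<Sum>i\<in>{0..<n}. int i) = int n * (int n - 1)" for n
      by (induction n) (auto simp: algebra_simps)
    from this[of "nat q"] have "2 * (\<Sum>i\<in>{0..<nat q}. int i) = int (nat q) * (int (nat q) - 1)" .
    moreover have "(\<Sum>i\<in>{0..<nat q}. int i) = (\<Sum>h\<in>{0..<q}. h)"
      by (rule sum.reindex_bij_witness[of _ nat int]) auto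
    ultimately show ?thesis using assms(1) by simp
  qed
  have bij: "bij_betw (\<lambda>h. (y + C * h) mod q) {0..<q} {0..<q}"
  proof -
    have inj: "inj_on (\<lambda>h. (y + C * h) mod q) {0..<q}"
    proof (rule inj_onI)
      fix g h assume *: "g \<in> {0..<q}" "h \<in> {0..<q}" "(y + C * g) mod q = (y + C * h) mod q"
      then have "[C * g = C * h] (mod q)"
        by (metis cong_add_lcancel cong_def)
      then have "[g = h] (mod q)" using assms(2) by (simp add: cong_mult_lcancel)
      then show "g = h" using * by (simp add: cong_def)
    qed
    moreover have "(\<lambda>h. (y + C * h) mod q) ` {0..<q} = {0..<q}"
      using inj assms(1) by (intro endo_inj_surj) auto
    ultimately show ?thesis by (simp add: bij_betw_def)
  qed
  have "q * (\<Sum>h\<in>{0..<q}. (y + C * h) div q) = (\<Sum>h\<in>{0..<q}. y + C * h) - (\<Sum>h\<in>{0..<q}. (y + C * h) mod q)"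
    by (simp add: sum_distrib_left minus_mod_eq_mult_div[symmetric] sum_subtractf)
  also have "(\<Sum>h\<in>{0..<q}. (y + C * h) mod q) = (\<Sum>h\<in>{0..<q}. h)"
    using sum.reindex_bij_betw[OF bij, of "\<lambda>h. h"] .
  finally have 1: "q * (\<Sum>h\<in>{0..<q}. (y + C * h) div q) = q * y + (C - 1) * (\<Sum>h\<in>{0..<q}. h)"
    using assms(1) by (simp add: sum.distrib left_diff_distrib flip: sum_distrib_left)
  obtain e where e: "C = 2 * e + 1" using assms(3) by (elim oddE)
  have "q * (\<Sum>h\<in>{0..<q}. (y + C * h) div q) = q * (y + e * (q - 1))"
    using 1 gauss by (simp add: e algebra_simps)
  then have "(\<Sum>h\<in>{0..<q}. (y + C * h) div q) = y + e * (q - 1)"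
    using assms(1) by simp
  then show ?thesis
    using assms(1) by (simp add: sum_subtractf e algebra_simps)
qed

lemma sum_atLeastLessThan_mult:
  fixes M q :: int
  assumes "M > 0" "q > 0"
  shows "(\<Sum>t\<in>{0..<M * q}. f t) = (\<Sum>t\<in>{0..<M}. \<Sum>h\<in>{0..<q}. f (t + M * h))"
proof -
  have "(\<Sum>t\<in>{0..<M * q}. f t) = (\<Sum>(t, h)\<in>{0..<M} \<times> {0..<q}. f (t + M * h))"
  proof (rule sum.reindex_bij_witness[of _ "\<lambda>(t, h). t + M * h" "\<lambda>t. (t mod M, t div M)"])
    fix t assume t: "t \<in> {0..<M * q}"
    then have "M * (t div M) + t mod M < M * q" by simp
    then have "M * (t div M) < M * q" using pos_mod_sign[OF assms(1), of t] by linarith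
    then have "t div M < q" "0 \<le> t div M"
      using t assms by (simp_all add: pos_imp_zdiv_nonneg_iff)
    then show "(t mod M, t div M) \<in> {0..<M} \<times> {0..<q}" using assms by auto
  next
    fix x assume "x \<in> {0..<M} \<times> {0..<q}"
    then obtain t h where th: "x = (t, h)" "0 \<le> t" "t < M" "0 \<le> h" "h < q" by auto
    have "M * (h + 1) \<le> M * q" using th assms by (intro mult_left_mono) auto
    then show "(case x of (t, h) \<Rightarrow> t + M * h) \<in> {0..<M * q}"
      using th assms by (auto simp: algebra_simps)
    show "((case x of (t, h) \<Rightarrow> t + M * h) mod M, (case x of (t, h) \<Rightarrow> t + M * h) div M) = x"
      using th by auto
  qed auto
  then show ?thesis by (simp add: sum.cartesian_product)
qed

lemma finite_residue_set [simp]: "finite {t. 0 \<le> t \<and> t < (x::int) \<and> P t}"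
  by (rule finite_subset[of _ "{0..<x}"]) auto

text \<open>For \<open>C t \<equiv> s\<close> modulo \<open>M = N m\<close> with \<open>0 \<le> s, t < M\<close>, the summand is
  \<open>(s/M - 1/2) - C (t/M - 1/2)\<close>, the value on \<open>s + M \<int>\<close> of the first Bernoulli distribution regularised
  by \<open>C\<close>. Summing over \<open>t\<close> instead of \<open>s\<close> avoids inverting \<open>C\<close> modulo \<open>M\<close>.\<close>

definition unit_weight :: "nat \<Rightarrow> nat \<Rightarrow> nat \<Rightarrow> int \<Rightarrow> int \<Rightarrow> int" where
  "unit_weight m a N C r =
     (\<Sum>t | t \<in> {0..<int N * int m} \<and> t mod int m = int a \<and> C * t mod int N = r.
        (C - 1) div 2 - C * t div (int N * int m))"

text \<open>Adding \<open>2 * N * m * L * z\<close> to \<open>C\<close> preserves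
  \<open>C * t mod N\<close>, adds \<open>N * m * L * z\<close> to the half and
  \<open>2 * L * z * t\<close> to the quotient. The 2 in the modulus is spent on the
  halving.\<close>

lemma unit_weight_cong:
  assumes "[C' = C] (mod (2 * int N * int m * int L))" "N > 0" "m > 0"
  shows "[unit_weight m a N C' r = unit_weight m a N C r] (mod int L)"
proof -
  obtain z where "C' = C + (2 * int N * int m * int L) * z"
    using assms(1) by (metis cong_iff_lin cong_sym)
  then have z: "C' = C + 2 * (int N * int m * int L * z)" by simp
  have "C' * t mod int N = C * t mod int N" for t
  proof -
    have "C' * t = C * t + int N * (2 * int m * int L * z * t)" by (simp add: z algebra_simps)
    then show ?thesis by simp
  qed
  moreover have "[(C' - 1) div 2 - C' * t div (int N * int m) = (C - 1) div 2 - C * t div (int N * int m)] (mod int L)" for t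
  proof -
    have "(C' - 1) div 2 = (C - 1 + 2 * (int N * int m * int L * z)) div 2" by (simp add: z)
    then have 1: "(C' - 1) div 2 = (C - 1) div 2 + int N * int m * int L * z" by simp
    have "C' * t = C * t + (int N * int m) * (2 * int L * z * t)" by (simp add: z algebra_simps)
    then have 2: "C' * t div (int N * int m) = C * t div (int N * int m) + 2 * int L * z * t"
      using assms(2,3) by simp
    show ?thesis unfolding 1 2 by (simp add: cong_iff_dvd_diff)
  qed
  ultimately show ?thesis
    unfolding unit_weight_def by (simp add: cong_sum)
qed

text \<open>Indices at level \<open>N * q\<close> are written \<open>t + ?M * h\<close> with
  \<open>h < q\<close>. The conditions modulo \<open>m\<close> and \<open>N\<close> see only
  \<open>t\<close>; dividing first by \<open>?M\<close> and then by \<open>q\<close> brings the sum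
  over \<open>h\<close> into the form of \<open>sum_progression_div\<close>.\<close>

lemma unit_weight_distribution:
  assumes "N > 0" "q > 0" "m > 0" "coprime C (int q)" "odd C" "r \<in> {0..<int N}"
  shows "(\<Sum>s\<in>{s \<in> {0..<int (N * q)}. s mod int N = r}. unit_weight m a (N * q) C s) = unit_weight m a N C r"
proof -
  let ?M = "int N * int m"
  let ?h = "\<lambda>t. (C - 1) div 2 - C * t div (?M * int q)"
  let ?S = "{t. t \<in> {0..<?M * int q} \<and> (t mod int m = int a \<and> C * t mod int N = r)}"
  let ?T = "{s \<in> {0..<int (N * q)}. s mod int N = r}"
  have M: "?M > 0" using assms by simp
  have Mq: "int (N * q) * int m = ?M * int q" by simp
  have "(\<Sum>s\<in>?T. unit_weight m a (N * q) C s) = (\<Sum>s\<in>?T. sum ?h {t \<in> ?S. C * t mod int (N * q) = s})"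
  proof (intro sum.cong refl)
    fix s assume s: "s \<in> ?T"
    have "{t. t \<in> {0..<int (N * q) * int m} \<and> t mod int m = int a \<and> C * t mod int (N * q) = s}
       = {t \<in> ?S. C * t mod int (N * q) = s}"
      using s unfolding Mq by (auto simp: mod_mod_cancel)
    then show "unit_weight m a (N * q) C s = sum ?h {t \<in> ?S. C * t mod int (N * q) = s}"
      unfolding unit_weight_def Mq by simp
  qed
  also have "\<dots> = sum ?h ?S"
    using assms by (intro sum.group) (auto simp: mod_mod_cancel simp flip: of_nat_mult)
  also have "\<dots> = (\<Sum>t\<in>{0..<?M * int q}. if t mod int m = int a \<and> C * t mod int N = r then ?h t else 0)"
    using sum.inter_filter[of "{0..<?M * int q}" ?h "\<lambda>t. t mod int m = int a \<and> C * t mod int N = r"] by simp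
  also have "\<dots> = (\<Sum>t\<in>{0..<?M}. \<Sum>h\<in>{0..<int q}. if (t + ?M * h) mod int m = int a \<and> C * (t + ?M * h) mod int N = r then ?h (t + ?M * h) else 0)"
    using assms M by (intro sum_atLeastLessThan_mult) auto
  also have "\<dots> = (\<Sum>t\<in>{0..<?M}. if t mod int m = int a \<and> C * t mod int N = r then (C - 1) div 2 - C * t div ?M else 0)"
  proof (intro sum.cong refl)
    fix t
    have 1: "(t + ?M * h) mod int m = t mod int m" for h
      by (simp add: mult.assoc mult.left_commute[of "int N"])
    have 2: "C * (t + ?M * h) mod int N = C * t mod int N" for h
    proof -
      have "C * (t + ?M * h) = C * t + int N * (C * int m * h)" by (simp add: algebra_simps)
      then show ?thesis by simp
    qed
    have 3: "C * (t + ?M * h) div (?M * int q) = (C * t div ?M + C * h) div int q" for h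
    proof -
      have "C * (t + ?M * h) = C * t + ?M * (C * h)" by (simp add: algebra_simps)
      then have "C * (t + ?M * h) div ?M = C * t div ?M + C * h"
        using M div_mult_self2[of ?M "C * t" "C * h"] by (simp only:)
      then show ?thesis by (simp add: zdiv_zmult2_eq)
    qed
    show "(\<Sum>h\<in>{0..<int q}. if (t + ?M * h) mod int m = int a \<and> C * (t + ?M * h) mod int N = r then ?h (t + ?M * h) else 0)
      = (if t mod int m = int a \<and> C * t mod int N = r then (C - 1) div 2 - C * t div ?M else 0)"
      unfolding 1 2 3 using sum_progression_div[of "int q" C "C * t div ?M"] assms
      by (cases "t mod int m = int a \<and> C * t mod int N = r") (simp, subst if_not_P, auto)
  qed
  also have "\<dots> = unit_weight m a N C r"
    unfolding unit_weight_def
    using sum.inter_filter[of "{0..<?M}" "\<lambda>t. (C - 1) div 2 - C * t div ?M" "\<lambda>t. t mod int m = int a \<and> C * t mod int N = r"] by simp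
  finally show ?thesis .
qed

text \<open>Coefficients are only needed modulo \<open>L\<close>, where \<open>unit_weight m a N C\<close> depends only on \<open>C\<close> modulo
  \<open>2 N m L\<close>; this is why \<open>c\<close> is evaluated at that level.\<close>

definition zeta_measure :: "nat \<Rightarrow> nat \<Rightarrow> (nat \<Rightarrow> int) \<Rightarrow> nat \<Rightarrow> int \<Rightarrow> nat \<Rightarrow> int" where
  "zeta_measure m a c = (\<lambda>N\<in>Zhat_index. \<lambda>r\<in>{0..<int N}. \<lambda>L\<in>Zhat_index.
     unit_weight m a N (c (2 * N * m * L)) r mod int L)"

lemma zeta_measure_in_measure_algebra:
  assumes "m > 0" "c \<in> carrier Zhat" "\<And>N. N > 0 \<Longrightarrow> coprime (c N) (int N)"
  shows "zeta_measure m a c \<in> measure_algebra Zhat_index Zhat_index"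
proof -
  have compat: "[c M = c N] (mod int N)" if "N dvd M" "M > 0" for N M
    using Zlim_carrierD(1)[OF assms(2), of N M] Zlim_carrierD(5)[OF assms(2), of N] that
    by (auto simp: Zhat_index_def cong_def dest: dvd_pos_nat)
  have 0: "0 \<notin> Zhat_index" by (simp add: Zhat_index_def)
  have w: "[unit_weight m a N (c M) r = unit_weight m a N (c (2 * N * m * L)) r] (mod int L)"
    if "2 * N * m * L dvd M" "M > 0" "N > 0" for N L r M
    using compat[OF that(1,2)] assms(1) that(3) by (intro unit_weight_cong) auto
  have car: "(\<lambda>L\<in>Zhat_index. unit_weight m a N (c (2 * N * m * L)) r mod int L) \<in> carrier Zhat"
    if "N > 0" for N r
    using that assms(1) by (intro Zlim_carrierI 0 w) (auto simp: Zhat_index_def)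
  have ext: "zeta_measure m a c N r = (\<lambda>L\<in>Zhat_index. unit_weight m a N (c (2 * N * m * L)) r mod int L)"
    if "N > 0" "r \<in> {0..<int N}" for N r
    using that by (simp add: zeta_measure_def Zhat_index_def)
  show ?thesis
    unfolding measure_algebra_def
  proof (intro CollectI conjI ballI impI)
    show "zeta_measure m a c \<in> (\<Pi>\<^sub>E N\<in>Zhat_index. {0..<int N} \<rightarrow>\<^sub>E carrier Zhat)"
      unfolding zeta_measure_def using car by (auto simp: Zhat_index_def PiE_iff)
  next
    fix N M r assume N: "N \<in> Zhat_index" and M: "M \<in> Zhat_index" and dvd: "N dvd M"
      and r: "r \<in> {0..<int N}"
    then obtain q where q: "M = N * q" by blast
    have pos: "N > 0" "q > 0" "M > 0" using N M q by (auto simp: Zhat_index_def)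
    let ?T = "{s \<in> {0..<int M}. s mod int N = r}"
    have T: "finite ?T" by simp
    have carT: "zeta_measure m a c M s \<in> carrier Zhat" if "s \<in> ?T" for s
      using ext[of M s] that car pos by simp
    interpret cring Zhat using 0 by (rule cring_Zlim)
    show "zeta_measure m a c N r = (\<Oplus>\<^bsub>Zhat\<^esub>s\<in>?T. zeta_measure m a c M s)"
    proof (rule Zlim_eqI)
      show "zeta_measure m a c N r \<in> carrier Zhat" using ext[of N r] car pos r by simp
      show "(\<Oplus>\<^bsub>Zhat\<^esub>s\<in>?T. zeta_measure m a c M s) \<in> carrier Zhat"
        using carT by (intro finsum_closed) auto
      fix L assume L: "L \<in> Zhat_index"
      then have Lpos: "L > 0" by (simp add: Zhat_index_def)
      \<comment> \<open>One integer serves both levels: it is odd and prime to \<open>q\<close>, as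
        the distribution relation needs, and by \<open>w\<close> it may replace the value of
        \<open>c\<close> used at the coarser level \<open>N\<close>.\<close>
      let ?C = "c (2 * M * m * L)"
      have cop: "coprime ?C (int (2 * M * m * L))" using assms pos Lpos by (intro assms(3)) simp
      then have "odd ?C" "coprime ?C (int q)"
        using q by (auto simp: coprime_mult_right_iff)
      then have "(\<Sum>s\<in>?T. unit_weight m a M ?C s) = unit_weight m a N ?C r"
        unfolding q using pos assms r by (intro unit_weight_distribution)
      also have "[unit_weight m a N ?C r = unit_weight m a N (c (2 * N * m * L)) r] (mod int L)"
        using pos Lpos assms q by (intro w) auto
      finally have main: "[(\<Sum>s\<in>?T. unit_weight m a M ?C s) = unit_weight m a N (c (2 * N * m * L)) r] (mod int L)" .
      have "(\<Oplus>\<^bsub>Zhat\<^esub>s\<in>?T. zeta_measure m a c M s) L = (\<Sum>s\<in>?T. zeta_measure m a c M s L) mod int L"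
        using carT L 0 by (intro Zlim_finsum_index) auto
      also have "\<dots> = (\<Sum>s\<in>?T. unit_weight m a M ?C s mod int L) mod int L"
        using ext[of M] L pos by simp
      also have "\<dots> = (\<Sum>s\<in>?T. unit_weight m a M ?C s) mod int L"
        by (simp add: mod_sum_eq)
      also have "\<dots> = unit_weight m a N (c (2 * N * m * L)) r mod int L"
        using main by (simp add: cong_def)
      also have "\<dots> = zeta_measure m a c N r L"
        using ext[of N r] pos r L by simp
      finally show "[zeta_measure m a c N r L = (\<Oplus>\<^bsub>Zhat\<^esub>s\<in>?T. zeta_measure m a c M s) L] (mod int L)"
        by simp
    qed
  qed
qed

section \<open>Power sums and Bernoulli polynomials\<close>

lemma rat_common_denominator:
  fixes q :: "'a \<Rightarrow> rat"
  assumes "finite A"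
  obtains D :: int where "D > 0" "\<And>x. x \<in> A \<Longrightarrow> of_int D * q x \<in> \<int>"
proof -
  have "\<exists>D>0::int. \<forall>x\<in>A. of_int D * q x \<in> \<int>"
    using assms
  proof induction
    case empty
    show ?case by (intro exI[of _ 1]) simp
  next
    case (insert y A)
    then obtain D where D: "D > 0" "\<forall>x\<in>A. of_int D * q x \<in> \<int>" by blast
    obtain u v where uv: "quotient_of (q y) = (u, v)" by force
    have v: "v > 0" and qy: "q y = of_int u / of_int v"
      using quotient_of_denom_pos[OF uv] quotient_of_div[OF uv] by auto
    have "of_int (D * v) * q x \<in> \<int>" if "x \<in> A" for x
    proof -
      have "of_int (D * v) * q x = of_int v * (of_int D * q x)" by simp
      moreover have "of_int v * (of_int D * q x) \<in> \<int>"
        using D that by (intro Ints_mult[of "of_int v" "of_int D * q x"]) auto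
      ultimately show ?thesis by (simp only:)
    qed
    moreover have "of_int (D * v) * q y = of_int (D * u)"
      using v by (simp add: qy)
    then have "of_int (D * v) * q y \<in> \<int>" by (metis Ints_of_int)
    ultimately show ?case using D v by (intro exI[of _ "D * v"]) auto
  qed
  then show ?thesis using that by blast
qed

text \<open>Division of power series is total, so multiplying back requires divisibility:
  \<open>fps_exp 1 - 1\<close> has order exactly 1, and the numerator has order at least 1.\<close>

lemma bernoulli_poly_generating_function:
  "Abs_fps (\<lambda>k. bernoulli_poly k T / fact k) * (fps_exp 1 - 1) = fps_X * fps_exp T"
proof -
  let ?E = "fps_exp 1 - 1 :: rat fps"
  have "?E \<noteq> 0" by simp
  have "subdegree ?E = 1" by (rule subdegreeI) auto
  moreover have "1 \<le> subdegree (fps_X * fps_exp T)"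
    by (rule subdegree_geI) (auto simp: less_Suc_eq_0_disj)
  ultimately have "?E dvd fps_X * fps_exp T"
    using \<open>?E \<noteq> 0\<close> by (simp add: fps_dvd_iff)
  moreover have "Abs_fps (\<lambda>k. bernoulli_poly k T / fact k) = fps_X * fps_exp T / ?E"
    by (intro fps_ext) (simp add: bernoulli_poly_def)
  ultimately show ?thesis by simp
qed

text \<open>Multiplied by \<open>fps_exp 1 - 1\<close>, the sum of exponentials telescopes. The
  factor \<open>fps_X\<close> is why coefficients of degree \<open>Suc k\<close> are
  compared.\<close>

lemma sum_powers_bernoulli:
  "(\<Sum>i<J. (T + of_nat i) ^ k) =
     (\<Sum>l\<le>k. fact k * bernoulli_poly l T / (fact l * fact (Suc k - l)) * of_nat J ^ (Suc k - l))"
proof -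
  let ?E = "fps_exp 1 - 1 :: rat fps" and ?B = "Abs_fps (\<lambda>k. bernoulli_poly k T / fact k)"
  have tel: "(\<Sum>i<J. fps_exp (T + of_nat i)) * ?E = fps_exp T * (fps_exp (of_nat J) - 1)"
  proof (induction J)
    case (Suc J)
    then show ?case
      by (simp add: algebra_simps fps_exp_add_mult)
  qed simp
  have "fps_X * (\<Sum>i<J. fps_exp (T + of_nat i)) * ?E = ?B * (fps_exp (of_nat J) - 1) * ?E"
    using bernoulli_poly_generating_function[of T] tel by (simp add: mult_ac)
  then have "fps_X * (\<Sum>i<J. fps_exp (T + of_nat i)) = ?B * (fps_exp (of_nat J) - 1)"
    by simp
  then have "fps_nth (fps_X * (\<Sum>i<J. fps_exp (T + of_nat i))) (Suc k)
      = fps_nth (?B * (fps_exp (of_nat J) - 1)) (Suc k)"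
    by simp
  then have "(\<Sum>i<J. (T + of_nat i) ^ k / fact k)
    = (\<Sum>l\<le>k. bernoulli_poly l T / fact l * (of_nat J ^ (Suc k - l) / fact (Suc k - l)))"
    unfolding fps_mult_nth[of ?B] by (simp add: fps_sum_nth atLeast0AtMost) (simp add: mult.commute)
  then have "(\<Sum>i<J. (T + of_nat i) ^ k) =
     fact k * (\<Sum>l\<le>k. bernoulli_poly l T / fact l * (of_nat J ^ (Suc k - l) / fact (Suc k - l)))"
    by (simp flip: sum_divide_distrib add: field_simps)
  then show ?thesis
    by (simp add: sum_distrib_left mult_ac)
qed

text \<open>Only the term \<open>l = k\<close> is linear in \<open>J\<close>; all others carry at
  least \<open>J ^ 2\<close>. A single \<open>D\<close> clears the denominators for all
  \<open>J\<close>, which keeps the error uniform when \<open>J\<close> runs through the powers of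
  \<open>p\<close>.\<close>

lemma sum_progression_powers_bernoulli:
  fixes m b k :: nat
  assumes "m > 0"
  obtains D G :: int where "D > 0"
    "of_int G = of_int D * of_nat m ^ k * bernoulli_poly k (of_nat b / of_nat m)"
    "\<And>J::nat. \<exists>z. D * (\<Sum>i<J. (int b + int m * int i) ^ k) = int J * G + int J ^ 2 * z"
proof -
  define T :: rat where "T = of_nat b / of_nat m"
  define q where "q l = of_nat m ^ k * (fact k * bernoulli_poly l T / (fact l * fact (Suc k - l)))" for l
  obtain D :: int where D: "D > 0" "\<And>l. l \<in> {..k} \<Longrightarrow> of_int D * q l \<in> \<int>"
    using rat_common_denominator[of "{..k}" q] by auto
  from D(2) have "\<forall>l\<in>{..k}. \<exists>c. of_int D * q l = of_int c"
    by (auto elim!: Ints_cases)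
  from bchoice[OF this] obtain c where c: "\<And>l. l \<le> k \<Longrightarrow> of_int D * q l = of_int (c l)"
    by auto
  have "of_int (D * (\<Sum>i<J. (int b + int m * int i) ^ k))
    = (of_int (int J * c k + int J ^ 2 * (\<Sum>l<k. c l * int J ^ (k - 1 - l))) :: rat)" for J
  proof -
    have "of_int (\<Sum>i<J. (int b + int m * int i) ^ k) = (\<Sum>i<J. of_nat m ^ k * (T + of_nat i) ^ k :: rat)"
    proof -
      have "of_int (int b + int m * int i) = of_nat m * (T + of_nat i)" for i
        using assms by (simp add: T_def distrib_left)
      then show ?thesis by (simp only: of_int_sum of_int_power power_mult_distrib)
    qed
    also have "\<dots> = (\<Sum>l\<le>k. q l * of_nat J ^ (Suc k - l))"
      unfolding sum_distrib_left[symmetric] sum_powers_bernoulli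
      by (simp only: sum_distrib_left q_def mult.assoc)
    finally have X: "of_int (\<Sum>i<J. (int b + int m * int i) ^ k) = (\<Sum>l\<le>k. q l * of_nat J ^ (Suc k - l))" .
    have "of_int (D * (\<Sum>i<J. (int b + int m * int i) ^ k))
        = (\<Sum>l\<le>k. (of_int D * q l) * of_nat J ^ (Suc k - l))"
      unfolding of_int_mult X by (simp only: sum_distrib_left mult.assoc)
    also have "\<dots> = (\<Sum>l\<le>k. of_int (c l) * of_nat J ^ (Suc k - l))"
      by (intro sum.cong refl) (simp add: c)
    also have "\<dots> = of_int (c k) * of_nat J + (\<Sum>l<k. of_int (c l) * of_nat J ^ (Suc k - l))"
      unfolding lessThan_Suc_atMost[symmetric] sum.lessThan_Suc by (simp add: add.commute)
    also have "(\<Sum>l<k. of_int (c l) * of_nat J ^ (Suc k - l))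
       = (\<Sum>l<k. of_nat J ^ 2 * (of_int (c l) * of_nat J ^ (k - 1 - l)) :: rat)"
    proof (intro sum.cong refl)
      fix l assume "l \<in> {..<k}"
      then have "Suc k - l = 2 + (k - 1 - l)" by auto
      then show "of_int (c l) * of_nat J ^ (Suc k - l)
        = (of_nat J ^ 2 * (of_int (c l) * of_nat J ^ (k - 1 - l)) :: rat)"
        by (simp add: power_add power2_eq_square mult_ac)
    qed
    also have "\<dots> = of_nat J ^ 2 * (\<Sum>l<k. of_int (c l) * of_nat J ^ (k - 1 - l))"
      by (simp only: sum_distrib_left)
    finally show ?thesis by simp
  qed
  then have "D * (\<Sum>i<J. (int b + int m * int i) ^ k)
    = int J * c k + int J ^ 2 * (\<Sum>l<k. c l * int J ^ (k - 1 - l))" for J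
    using of_int_eq_iff by blast
  moreover have "of_int (c k) = of_int D * of_nat m ^ k * bernoulli_poly k (of_nat b / of_nat m)"
    using c[of k] by (simp add: q_def T_def)
  ultimately show ?thesis
    using that[of D "c k"] D(1) by blast
qed

section \<open>Power sums over a residue class with the multiples of \<open>p\<close>
  removed\<close>

lemma bracket_div_properties:
  assumes "coprime m a" "m > 1" "0 < a" "a < m" "coprime p m"
  defines "b \<equiv> bracket_div m a p"
  shows "0 < b" "b < m" "[b * p = a] (mod m)"
proof -
  let ?P = "\<lambda>x. 0 < x \<and> [x * p = a] (mod m)"
  obtain y where y: "[p * y = 1] (mod m)"
    using assms(5) cong_solve_coprime_nat by auto
  \<comment> \<open>The reduced representative of \<open>a / p\<close> modulo \<open>m\<close>. It
    is positive because \<open>a\<close> is nonzero modulo \<open>m\<close>, so it bounds the least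
    solution and keeps that below \<open>m\<close>.\<close>
  define x where "x = (a * y) mod m"
  have "[x * p = a * y * p] (mod m)"
    by (simp add: x_def cong_def mod_simps)
  also have "[a * y * p = a * 1] (mod m)"
    using cong_scalar_left[OF y, of a] by (simp add: mult_ac)
  finally have x: "[x * p = a] (mod m)" by simp
  moreover have "x > 0"
    using x assms(3,4) by (cases "x = 0") (auto simp: cong_def)
  ultimately have Px: "?P x" by simp
  show "0 < b" "[b * p = a] (mod m)"
    using LeastI[of ?P, OF Px] by (auto simp: b_def bracket_div_def)
  have "b \<le> x"
    using Least_le[of ?P, OF Px] by (simp add: b_def bracket_div_def)
  also have "x < m" using assms(2) by (simp add: x_def)
  finally show "b < m" .
qed

lemma sum_progression:
  fixes f :: "int \<Rightarrow> int"
  assumes "a < m"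
  shows "(\<Sum>t | t \<in> {0..<int N * int m} \<and> t mod int m = int a. f t) = (\<Sum>i<N. f (int a + int m * int i))"
proof (rule sum.reindex_bij_witness[of _ "\<lambda>i. int a + int m * int i" "\<lambda>t. nat (t div int m)"])
  fix i assume "i \<in> {..<N}"
  then have "int m * (int i + 1) \<le> int m * int N"
    by (intro mult_left_mono) auto
  then show "int a + int m * int i \<in> {t. t \<in> {0..<int N * int m} \<and> t mod int m = int a}"
    using assms by (auto simp: algebra_simps)
next
  fix t assume t: "t \<in> {t. t \<in> {0..<int N * int m} \<and> t mod int m = int a}"
  then have nn: "t div int m \<ge> 0" using assms by (auto intro: pos_imp_zdiv_nonneg_iff[THEN iffD2])
  have eq: "int a + int m * (t div int m) = t"
    using t mod_mult_div_eq[of t "int m"] by auto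
  with nn show "int a + int m * int (nat (t div int m)) = t" by simp
  have "t div int m < int N"
  proof -
    have "int m * (t div int m) < int m * int N" using t eq by (auto simp: mult.commute)
    then show ?thesis using assms by simp
  qed
  then show "nat (t div int m) \<in> {..<N}" using nn by auto
  show "f (int a + int m * int (nat (t div int m))) = f t"
    using eq nn by simp
qed (use assms in auto)

definition moment_set :: "nat \<Rightarrow> nat \<Rightarrow> nat \<Rightarrow> nat \<Rightarrow> int set" where
  "moment_set p m a N = {t \<in> {0..<int N * int m}. t mod int m = int a \<and> \<not> int p dvd t}"

text \<open>If \<open>p\<close> divides \<open>m\<close>, then \<open>p\<close> is prime to
  \<open>a\<close> and nothing has to be removed. Otherwise the removed elements are
  \<open>p * s\<close> with \<open>s\<close> in the class of \<open>bracket_div m a p\<close>; the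
  range of \<open>s\<close> is shorter by the factor \<open>p\<close>, hence \<open>p ^ j\<close>
  against \<open>p ^ Suc j\<close>.\<close>

lemma sum_moment_set:
  assumes "coprime m a" "m > 1" "0 < a" "a < m" "Factorial_Ring.prime p"
  shows "(\<Sum>t\<in>moment_set p m a (p ^ Suc j). t ^ k) =
    (\<Sum>i<p ^ Suc j. (int a + int m * int i) ^ k) -
    (if p dvd m then 0 else int p ^ k * (\<Sum>i<p ^ j. (int (bracket_div m a p) + int m * int i) ^ k))"
proof -
  let ?N = "p ^ Suc j" and ?b = "bracket_div m a p"
  let ?U = "{t. t \<in> {0..<int ?N * int m} \<and> t mod int m = int a}"
  let ?V = "{t \<in> ?U. int p dvd t}"
  have p: "p > 0" using assms(5) by (simp add: prime_gt_0_nat)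
  have "moment_set p m a ?N = ?U - ?V" by (auto simp: moment_set_def)
  moreover have "finite ?U" by (rule finite_subset[of _ "{0..<int ?N * int m}"]) auto
  ultimately have 1: "(\<Sum>t\<in>moment_set p m a ?N. t ^ k) = (\<Sum>t\<in>?U. t ^ k) - (\<Sum>t\<in>?V. t ^ k)"
    by (simp only:) (rule sum_diff, auto)
  have 2: "(\<Sum>t\<in>?U. t ^ k) = (\<Sum>i<?N. (int a + int m * int i) ^ k)"
    using assms by (intro sum_progression)
  have "(\<Sum>t\<in>?V. t ^ k) = (if p dvd m then 0 else int p ^ k * (\<Sum>i<p ^ j. (int ?b + int m * int i) ^ k))"
  proof (cases "p dvd m")
    case True
    have "?V = {}"
    proof (rule ccontr)
      assume "?V \<noteq> {}"
      then obtain t where t: "t mod int m = int a" "int p dvd t" by blast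
      then have "int p dvd int a" using True dvd_mod[of "int p" t "int m"] by simp
      with True assms(1,5) show False
        by (metis coprime_def int_dvd_int_iff not_prime_unit)
    qed
    then show ?thesis using True by (simp only: sum.empty if_True)
  next
    case False
    then have cop: "coprime p m" using assms(5) by (simp add: prime_imp_coprime)
    note b = bracket_div_properties[OF assms(1-4) cop]
    have "[int ?b * int p = int a] (mod int m)"
      using b(3) by (metis cong_int_iff of_nat_mult)
    then have bp: "[int p * int ?b = int a] (mod int m)" by (simp add: mult.commute)
    let ?W = "{s. s \<in> {0..<int (p ^ j) * int m} \<and> s mod int m = int ?b}"
    have "(\<Sum>t\<in>?V. t ^ k) = (\<Sum>s\<in>?W. (int p * s) ^ k)"
    proof (rule sum.reindex_bij_witness[of _ "\<lambda>s. int p * s" "\<lambda>t. t div int p"])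
      fix t assume t: "t \<in> ?V"
      then obtain s where s: "t = int p * s" by auto
      have "[int p * s = int p * int ?b] (mod int m)"
        using t bp assms(4) by (auto simp: s cong_def)
      then have "[s = int ?b] (mod int m)"
        using cop by (simp add: cong_mult_lcancel)
      then have "s mod int m = int ?b" using b by (simp add: cong_def)
      moreover have "int p * s < int p * (int (p ^ j) * int m)" "0 \<le> int p * s"
        using t by (auto simp: s mult_ac)
      then have "s < int (p ^ j) * int m" "0 \<le> s"
        using p by (auto simp: zero_le_mult_iff)
      ultimately show "t div int p \<in> ?W" using p by (simp add: s)
      show "int p * (t div int p) = t" "(int p * (t div int p)) ^ k = t ^ k"
        using s p by simp_all
    next
      fix s assume s: "s \<in> ?W"
      show "int p * s div int p = s" using p by simp
      have "[s = int ?b] (mod int m)" using s b by (auto simp: cong_def)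
      then have "[int p * s = int a] (mod int m)"
        using cong_trans[OF cong_scalar_left bp] by blast
      then have "int p * s mod int m = int a" using assms by (simp add: cong_def)
      moreover have "int p * s < int p * (int (p ^ j) * int m)"
        using s p by (intro mult_strict_left_mono) auto
      ultimately show "int p * s \<in> ?V" using s by (auto simp: mult_ac)
    qed
    also have "\<dots> = int p ^ k * (\<Sum>s\<in>?W. s ^ k)"
      by (simp only: power_mult_distrib sum_distrib_left)
    also have "(\<Sum>s\<in>?W. s ^ k) = (\<Sum>i<p ^ j. (int ?b + int m * int i) ^ k)"
      using b by (intro sum_progression)
    finally show ?thesis using False by simp
  qed
  then show ?thesis unfolding 1 2 by (simp only:)
qed

text \<open>Intended for the exponent \<open>k - 1\<close>, which may be 0, and where the size
  suffices without the leading term. The factor \<open>p\<close> in the witness compensates for the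
  removed sum having only \<open>p ^ j\<close> terms.\<close>

lemma moment_set_power_sum_dvd:
  assumes "coprime m a" "m > 1" "0 < a" "a < m" "Factorial_Ring.prime p"
  obtains K :: int where "K > 0"
    "\<And>j. int (p ^ Suc j) dvd K * (\<Sum>t\<in>moment_set p m a (p ^ Suc j). t ^ k)"
proof -
  let ?b = "bracket_div m a p"
  have m: "m > 0" using assms by simp
  obtain D1 G1 where 1: "D1 > 0"
    "\<And>J::nat. \<exists>z. D1 * (\<Sum>i<J. (int a + int m * int i) ^ k) = int J * G1 + int J ^ 2 * z"
    by (rule sum_progression_powers_bernoulli[OF m, of k a]) blast
  obtain D2 G2 where 2: "D2 > 0"
    "\<And>J::nat. \<exists>z. D2 * (\<Sum>i<J. (int ?b + int m * int i) ^ k) = int J * G2 + int J ^ 2 * z"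
    by (rule sum_progression_powers_bernoulli[OF m, of k ?b]) blast
  show ?thesis
  proof
    show "D1 * D2 * int p > 0" using 1(1) 2(1) assms(5) by (simp add: prime_gt_0_nat)
    fix j
    let ?S1 = "\<Sum>i<p ^ Suc j. (int a + int m * int i) ^ k"
    let ?S2 = "\<Sum>i<p ^ j. (int ?b + int m * int i) ^ k"
    have d1: "int (p ^ Suc j) dvd D1 * ?S1"
      using 1(2)[of "p ^ Suc j"] by (auto simp: power2_eq_square mult.assoc simp del: power_Suc)
    have "int (p ^ j) dvd D2 * ?S2"
      using 2(2)[of "p ^ j"] by (auto simp: power2_eq_square mult.assoc)
    then have d2: "int (p ^ Suc j) dvd int p * (D2 * ?S2)" by simp
    let ?e = "if p dvd m then 0 else int p ^ k"
    have "(\<Sum>t\<in>moment_set p m a (p ^ Suc j). t ^ k) = ?S1 - ?e * ?S2"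
      by (simp only: sum_moment_set[OF assms] if_distrib[of "\<lambda>x. x * _"] mult_zero_left)
    moreover have "D1 * D2 * int p * (x - ?e * y) = D2 * int p * (D1 * x) - D1 * ?e * (int p * (D2 * y))" for x y
      by (simp only: algebra_simps)
    ultimately show "int (p ^ Suc j) dvd D1 * D2 * int p * (\<Sum>t\<in>moment_set p m a (p ^ Suc j). t ^ k)"
      by (simp only:) (intro dvd_diff dvd_mult d1 d2)
  qed
qed

lemma moment_set_power_sum:
  assumes "coprime m a" "m > 1" "0 < a" "a < m" "Factorial_Ring.prime p" "k \<ge> 1"
  obtains K G :: int where "K > 0"
    "of_int G = of_int K * (of_nat m ^ k * (bernoulli_poly k (of_nat a / of_nat m) -
       (if p dvd m then 0 else of_nat p ^ (k - 1) * bernoulli_poly k (of_nat (bracket_div m a p) / of_nat m))))"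
    "\<And>j. \<exists>z. K * (\<Sum>t\<in>moment_set p m a (p ^ Suc j). t ^ k) = int (p ^ Suc j) * G + int (p ^ Suc j) ^ 2 * z"
proof -
  let ?b = "bracket_div m a p"
  have m: "m > 0" using assms by simp
  obtain k' where k': "k = Suc k'" using assms(6) by (cases k) auto
  obtain D1 G1 where 1: "D1 > 0"
    "of_int G1 = of_int D1 * of_nat m ^ k * bernoulli_poly k (of_nat a / of_nat m)"
    "\<And>J::nat. \<exists>z. D1 * (\<Sum>i<J. (int a + int m * int i) ^ k) = int J * G1 + int J ^ 2 * z"
    by (rule sum_progression_powers_bernoulli[OF m, of k a]) blast
  obtain D2 G2 where 2: "D2 > 0"
    "of_int G2 = of_int D2 * of_nat m ^ k * bernoulli_poly k (of_nat ?b / of_nat m)"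
    "\<And>J::nat. \<exists>z. D2 * (\<Sum>i<J. (int ?b + int m * int i) ^ k) = int J * G2 + int J ^ 2 * z"
    by (rule sum_progression_powers_bernoulli[OF m, of k ?b]) blast
  define \<epsilon> :: int where "\<epsilon> = (if p dvd m then 0 else 1)"
  \<comment> \<open>Since \<open>?N = p * ?J\<close>, a removed term \<open>p ^ k * ?J\<close>
    equals \<open>p ^ (k - 1) * ?N\<close>, the source of the exponent \<open>k - 1\<close>. The
    extra factor \<open>p\<close> in the multiplier keeps the \<open>?J ^ 2\<close> part a multiple
    of \<open>?N ^ 2\<close> even for \<open>k = 1\<close>.\<close>
  define G where "G = int p * D2 * G1 - \<epsilon> * int p ^ k * D1 * G2"
  show ?thesis
  proof
    show "D1 * D2 * int p > 0" using 1(1) 2(1) assms(5) by (simp add: prime_gt_0_nat)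
    show "of_int G = of_int (D1 * D2 * int p) * (of_nat m ^ k * (bernoulli_poly k (of_nat a / of_nat m) -
       (if p dvd m then 0 else of_nat p ^ (k - 1) * bernoulli_poly k (of_nat ?b / of_nat m))))"
      by (simp add: G_def 1(2) 2(2) \<epsilon>_def k' algebra_simps)
    fix j
    let ?S1 = "\<Sum>i<p ^ Suc j. (int a + int m * int i) ^ k"
    let ?S2 = "\<Sum>i<p ^ j. (int ?b + int m * int i) ^ k"
    let ?N = "int (p ^ Suc j)" and ?J = "int (p ^ j)"
    obtain z1 where z1: "D1 * ?S1 = ?N * G1 + ?N ^ 2 * z1" using 1(3) by blast
    obtain z2 where z2: "D2 * ?S2 = ?J * G2 + ?J ^ 2 * z2" using 2(3) by blast
    have S: "(\<Sum>t\<in>moment_set p m a (p ^ Suc j). t ^ k) = ?S1 - \<epsilon> * (int p ^ k * ?S2)"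
      by (simp only: sum_moment_set[OF assms(1-5)] \<epsilon>_def if_distrib[of "\<lambda>x. x * _"] mult_zero_left mult_1)
    have N: "?N = int p * ?J" by simp
    have "D1 * D2 * int p * (x - \<epsilon> * (int p ^ k * y)) = ?N * G + ?N ^ 2 * (int p * D2 * z1 - \<epsilon> * int p ^ k' * D1 * z2)"
      if "D1 * x = ?N * G1 + ?N ^ 2 * z1" "D2 * y = ?J * G2 + ?J ^ 2 * z2" for x y
    proof -
      have "D1 * D2 * int p * (x - \<epsilon> * (int p ^ k * y))
        = int p * D2 * (D1 * x) - \<epsilon> * (int p ^ k * int p) * D1 * (D2 * y)"
        by (simp only: algebra_simps)
      also have "\<dots> = ?N * G + ?N ^ 2 * (int p * D2 * z1 - \<epsilon> * int p ^ k' * D1 * z2)"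
        unfolding that N by (simp add: G_def k' algebra_simps power2_eq_square)
      finally show ?thesis .
    qed
    from this[OF z1 z2]
    show "\<exists>z. D1 * D2 * int p * (\<Sum>t\<in>moment_set p m a (p ^ Suc j). t ^ k) = ?N * G + ?N ^ 2 * z"
      unfolding S by blast
  qed
qed

section \<open>The moments of the measure\<close>

lemma diff_power_cong_square:
  fixes x y :: int
  shows "[(x - y) ^ k = x ^ k - int k * x ^ (k - 1) * y] (mod y\<^sup>2)"
proof (induction k)
  case (Suc k)
  have 1: "[(x - y) * (x - y) ^ k = (x - y) * (x ^ k - int k * x ^ (k - 1) * y)] (mod y\<^sup>2)"
    using Suc by (rule cong_scalar_left)
  have 2: "(x - y) * (x ^ k - int k * x ^ (k - 1) * y)
    = x ^ Suc k - int (Suc k) * x ^ k * y + y\<^sup>2 * (int k * x ^ (k - 1))"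
    by (cases k) (simp_all add: algebra_simps power2_eq_square)
  have "[x ^ Suc k - int (Suc k) * x ^ k * y + y\<^sup>2 * (int k * x ^ (k - 1))
    = x ^ Suc k - int (Suc k) * x ^ k * y] (mod y\<^sup>2)"
    by (simp add: cong_iff_dvd_diff)
  from cong_trans[OF 1[unfolded 2] this] show ?case
    by simp
qed simp

lemma cong_mult_modulus:
  fixes u v M N c :: int
  assumes "[u = v] (mod N)"
  shows "[c * M * u = c * M * v] (mod (M * N))"
proof -
  obtain w where "u - v = N * w"
    using assms by (auto simp: cong_iff_dvd_diff)
  then have "c * M * (u - v) = M * N * (c * w)"
    by simp
  then have "c * M * u - c * M * v = M * N * (c * w)"
    by (simp add: right_diff_distrib)
  then show ?thesis by (simp add: cong_iff_dvd_diff)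
qed

text \<open>Expanding the power of \<open>x mod M = x - M * (x div M)\<close> to first order trades
  the floor \<open>x div M\<close> for a difference of \<open>k\<close>-th powers. The error is a
  multiple of \<open>M ^ 2\<close>; replacing \<open>x mod N\<close> by \<open>x\<close> costs a
  multiple of \<open>N\<close>, scaled by \<open>M\<close>.\<close>

lemma mod_power_cong:
  fixes x M :: int
  assumes "N dvd M"
  shows "[int k * M * ((x mod N) ^ (k - 1) * (e - x div M))
    = int k * M * e * x ^ (k - 1) + ((x mod M) ^ k - x ^ k)] (mod (M * N))"
proof -
  have "[(x mod N) ^ (k - 1) * (e - x div M) = x ^ (k - 1) * (e - x div M)] (mod N)"
    by (intro cong_mult cong_pow) auto
  then have "[int k * M * ((x mod N) ^ (k - 1) * (e - x div M))
     = int k * M * (x ^ (k - 1) * (e - x div M))] (mod (M * N))"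
    by (rule cong_mult_modulus)
  moreover have "[(x mod M) ^ k - x ^ k = - (int k * x ^ (k - 1) * (M * (x div M)))] (mod (M * N))"
  proof -
    have "[(x - M * (x div M)) ^ k = x ^ k - int k * x ^ (k - 1) * (M * (x div M))]
       (mod (M * (x div M))\<^sup>2)"
      by (rule diff_power_cong_square)
    moreover have "M * N dvd (M * (x div M))\<^sup>2"
      using assms by (auto simp: power2_eq_square intro: mult_dvd_mono)
    ultimately have "[(x mod M) ^ k = x ^ k - int k * x ^ (k - 1) * (M * (x div M))] (mod (M * N))"
      by (metis cong_dvd_modulus minus_mult_div_eq_mod)
    then show ?thesis
      by (simp add: cong_iff_dvd_diff algebra_simps)
  qed
  ultimately have "[int k * M * ((x mod N) ^ (k - 1) * (e - x div M))
     - ((x mod M) ^ k - x ^ k) = int k * M * (x ^ (k - 1) * (e - x div M))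
      - (- (int k * x ^ (k - 1) * (M * (x div M))))] (mod (M * N))"
    by (rule cong_diff)
  then show ?thesis
    by (simp add: cong_iff_dvd_diff algebra_simps)
qed

text \<open>Multiplication by \<open>C\<close> keeps the class of \<open>a\<close> because
  \<open>C\<close> is 1 modulo \<open>m\<close>, and keeps non-divisibility by \<open>p\<close>
  because \<open>C\<close> is prime to \<open>p\<close>. Injectivity on a finite set does the
  rest.\<close>

lemma bij_betw_moment_set:
  assumes "coprime C (int N * int m)" "[C = 1] (mod int m)" "p dvd N" "m > 0" "N > 0"
  shows "bij_betw (\<lambda>t. C * t mod (int N * int m)) (moment_set p m a N) (moment_set p m a N)"
proof -
  let ?M = "int N * int m" and ?A = "moment_set p m a N"
  let ?f = "\<lambda>t. C * t mod ?M"
  have fin: "finite ?A"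
    by (rule finite_subset[of _ "{0..<?M}"]) (auto simp: moment_set_def)
  have M: "?M > 0" using assms by simp
  have inj: "inj_on ?f ?A"
  proof (rule inj_onI)
    fix t s assume ts: "t \<in> ?A" "s \<in> ?A" "?f t = ?f s"
    then have "[C * t = C * s] (mod ?M)" by (simp add: cong_def)
    then have "[t = s] (mod ?M)"
      using assms(1) by (simp add: cong_mult_lcancel)
    then show "t = s"
      using ts by (simp add: cong_def moment_set_def)
  qed
  moreover have "?f ` ?A \<subseteq> ?A"
  proof safe
    fix t assume t: "t \<in> ?A"
    have "?f t mod int m = C * t mod int m"
      by (simp add: mod_mod_cancel)
    also have "\<dots> = 1 * t mod int m"
      using assms(2) by (metis cong_def cong_scalar_right)
    finally have 1: "?f t mod int m = int a"
      using t by (simp add: moment_set_def)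
    have "int p dvd ?M" using assms(3) by simp
    moreover have "coprime C (int p)"
      using assms(1) \<open>int p dvd ?M\<close> by (meson coprime_divisors dvd_refl)
    ultimately have "\<not> int p dvd ?f t"
      using t by (simp add: dvd_mod_iff coprime_commute coprime_dvd_mult_right_iff moment_set_def)
    then show "?f t \<in> ?A"
      using 1 M by (simp add: moment_set_def)
  qed
  then have "?f ` ?A = ?A"
    using inj fin by (intro endo_inj_surj)
  ultimately show ?thesis by (simp add: bij_betw_def)
qed

text \<open>\<open>mod_power_cong\<close> is summed with \<open>x = C * t\<close>. Since
  multiplication by \<open>C\<close> permutes \<open>A\<close>, the reduced powers sum to the same
  value as \<open>t ^ k\<close>, which produces \<open>1 - C ^ k\<close>. The number
  \<open>e\<close> can stay arbitrary, as its term drops out later by divisibility.\<close>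

lemma moment_cong_power_sums:
  fixes a :: nat
  assumes "coprime C (int N * int m)" "[C = 1] (mod int m)" "p dvd N" "m > 0" "N > 0"
  defines "M \<equiv> int N * int m" and "A \<equiv> moment_set p m a N"
  shows "[int k * M * (\<Sum>t\<in>A. (C * t mod int N) ^ (k - 1) * (e - C * t div M))
    = int k * M * (e * C ^ (k - 1)) * (\<Sum>t\<in>A. t ^ (k - 1)) + (1 - C ^ k) * (\<Sum>t\<in>A. t ^ k)] (mod (M * int N))"
proof -
  have "[(\<Sum>t\<in>A. int k * M * ((C * t mod int N) ^ (k - 1) * (e - C * t div M)))
    = (\<Sum>t\<in>A. int k * M * e * (C * t) ^ (k - 1) + ((C * t mod M) ^ k - (C * t) ^ k))] (mod (M * int N))"
    by (intro cong_sum mod_power_cong) (simp add: M_def)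
  moreover have "(\<Sum>t\<in>A. (C * t mod M) ^ k) = (\<Sum>t\<in>A. t ^ k)"
    using sum.reindex_bij_betw[OF bij_betw_moment_set[OF assms(1-5)], of "\<lambda>t. t ^ k"]
    by (simp add: M_def A_def)
  ultimately show ?thesis
    by (simp add: sum.distrib sum_subtractf power_mult_distrib sum_distrib_left algebra_simps)
qed

text \<open>After multiplication by \<open>K1 * K2\<close> all terms are multiples of
  \<open>N\<close>, and dividing by \<open>N\<close> leaves a congruence modulo \<open>N\<close>.
  The \<open>T1\<close> term carried a second factor \<open>N\<close> and disappears; from
  \<open>T2\<close> only the leading coefficient \<open>G\<close> survives.\<close>

lemma cong_clear_denominators:
  fixes N :: int
  assumes "[k * (N * m) * S = k * (N * m) * E * T1 + c * T2] (mod (N * m * N))"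
    and "N dvd K1 * T1" and "K2 * T2 = N * G + N\<^sup>2 * z" and "N \<noteq> 0"
  shows "[K1 * K2 * k * m * S = c * (K1 * G)] (mod N)"
proof -
  obtain y where y: "K1 * T1 = N * y" using assms(2) by (elim dvdE)
  obtain w where w: "k * (N * m) * S - (k * (N * m) * E * T1 + c * T2) = N * m * N * w"
    using assms(1) unfolding cong_iff_dvd_diff by (elim dvdE)
  have "N * (K1 * K2 * k * m * S - c * (K1 * G)) =
      K1 * K2 * (k * (N * m) * S - (k * (N * m) * E * T1 + c * T2))
      + k * N * m * E * K2 * (K1 * T1) + c * K1 * (K2 * T2) - N * c * K1 * G"
    by (simp add: algebra_simps)
  also have "\<dots> = N * (N * (K1 * K2 * m * w + k * m * E * K2 * y + c * K1 * z))"
    unfolding w y assms(3) by (simp add: algebra_simps power2_eq_square)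
  finally have "K1 * K2 * k * m * S - c * (K1 * G) = N * (K1 * K2 * m * w + k * m * E * K2 * y + c * K1 * z)"
    using assms(4) by simp
  then show ?thesis by (simp add: cong_iff_dvd_diff)
qed

text \<open>\<open>K\<close> and \<open>H\<close> are independent of \<open>j\<close>,
  \<open>C\<close> and \<open>e\<close>, so the precision lost by clearing denominators stays
  bounded as \<open>j\<close> grows.\<close>

lemma moment_cong_bernoulli:
  assumes "coprime m a" "m > 1" "0 < a" "a < m" "Factorial_Ring.prime p" "k \<ge> 1"
  defines "R \<equiv> of_nat m ^ (k - 1) / of_nat k * (bernoulli_poly k (of_nat a / of_nat m) -
       (if p dvd m then 0 else of_nat p ^ (k - 1) * bernoulli_poly k (of_nat (bracket_div m a p) / of_nat m)))"
  obtains K H :: int where "K > 0" "of_int H = of_int K * R"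
    "\<And>j C e. coprime C (int (p ^ Suc j) * int m) \<Longrightarrow> [C = 1] (mod int m) \<Longrightarrow>
       [K * (\<Sum>t\<in>moment_set p m a (p ^ Suc j). (C * t mod int (p ^ Suc j)) ^ (k - 1)
              * (e - C * t div (int (p ^ Suc j) * int m))) = (1 - C ^ k) * H] (mod int (p ^ Suc j))"
proof -
  obtain K1 where K1: "K1 > 0"
    "\<And>j. int (p ^ Suc j) dvd K1 * (\<Sum>t\<in>moment_set p m a (p ^ Suc j). t ^ (k - 1))"
    by (rule moment_set_power_sum_dvd[OF assms(1-5)]) blast
  obtain K2 G where K2: "K2 > 0"
    "of_int G = of_int K2 * (of_nat m ^ k * (bernoulli_poly k (of_nat a / of_nat m) -
       (if p dvd m then 0 else of_nat p ^ (k - 1) * bernoulli_poly k (of_nat (bracket_div m a p) / of_nat m))))"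
    "\<And>j. \<exists>z. K2 * (\<Sum>t\<in>moment_set p m a (p ^ Suc j). t ^ k) = int (p ^ Suc j) * G + int (p ^ Suc j) ^ 2 * z"
    by (rule moment_set_power_sum[OF assms(1-6)]) blast
  define K where "K = K1 * K2"
  show ?thesis
  proof
    show "K * int k * int m > 0" using K1 K2 assms by (simp add: K_def)
    obtain k' where k': "k = Suc k'" using assms(6) by (cases k) auto
    \<comment> \<open>\<open>G\<close> carries \<open>m ^ k\<close> where \<open>R\<close> has
      \<open>m ^ (k - 1) / k\<close>; the factors \<open>k\<close> and \<open>m\<close> of the
      multiplier account for the difference.\<close>
    show "of_int (K1 * G) = of_int (K * int k * int m) * R"
      using assms(2) by (simp add: K2(2) K_def R_def k')
    fix j C e
    assume C: "coprime C (int (p ^ Suc j) * int m)" "[C = 1] (mod int m)"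
    let ?N = "int (p ^ Suc j)"
    let ?M = "?N * int m"
    let ?S = "\<Sum>t\<in>moment_set p m a (p ^ Suc j). (C * t mod ?N) ^ (k - 1) * (e - C * t div ?M)"
    let ?T = "\<lambda>l. \<Sum>t\<in>moment_set p m a (p ^ Suc j). t ^ l"
    have N: "?N > 0" using assms(5) by (simp add: prime_gt_0_nat)
    have "[int k * ?M * ?S = int k * ?M * (e * C ^ (k - 1)) * ?T (k - 1) + (1 - C ^ k) * ?T k] (mod (?M * ?N))"
      using C assms by (intro moment_cong_power_sums) (auto simp: prime_gt_0_nat)
    moreover obtain z where "K2 * ?T k = ?N * G + ?N ^ 2 * z" using K2(3) by blast
    moreover note N[THEN less_imp_neq, symmetric]
    ultimately show "[K * int k * int m * ?S = (1 - C ^ k) * (K1 * G)] (mod ?N)"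
      unfolding K_def by (intro cong_clear_denominators[OF _ K1(2)[of j]])
  qed
qed

text \<open>The sums defining \<open>unit_weight\<close> are the fibres of \<open>t\<close> going to
  \<open>C * t mod p ^ j\<close>. As \<open>C\<close> is prime to \<open>p\<close>, the fibres over
  residues prime to \<open>p\<close> make up exactly \<open>moment_set\<close>, so the double sum
  collapses.\<close>

lemma unit_moment_zeta_measure:
  assumes p: "Factorial_Ring.prime p" and j: "j > 0" and m: "m > 0"
    and cop: "coprime (c (2 * p ^ j * m * p ^ j)) (int p)"
  defines "C \<equiv> c (2 * p ^ j * m * p ^ j)"
  shows "[unit_moment p (zeta_measure m a c) k j =
    (\<Sum>t\<in>moment_set p m a (p ^ j). (C * t mod int (p ^ j)) ^ k *
       ((C - 1) div 2 - C * t div (int (p ^ j) * int m)))] (mod int (p ^ j))"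
proof -
  let ?N = "p ^ j"
  let ?U = "{r \<in> {0..<int ?N}. \<not> int p dvd r}"
  let ?A = "moment_set p m a ?N"
  let ?g = "\<lambda>t. C * t mod int ?N"
  define w where "w t = (C - 1) div 2 - C * t div (int ?N * int m)" for t
  define F where "F t = ?g t ^ k * w t" for t
  have N0: "?N > 0" using p by (simp add: prime_gt_0_nat)
  have idx: "?N \<in> Zhat_index" using N0 by (simp add: Zhat_index_def)
  have fin: "finite ?U" "finite ?A" by (simp_all add: moment_set_def)
  have pd: "int p dvd ?g t \<longleftrightarrow> int p dvd t" for t
  proof -
    have "int p dvd int ?N" using j by (auto intro: dvd_power)
    then have "int p dvd ?g t \<longleftrightarrow> int p dvd C * t" by (rule dvd_mod_iff)
    also have "\<dots> \<longleftrightarrow> int p dvd t"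
      using cop by (intro coprime_dvd_mult_right_iff) (simp add: C_def coprime_commute)
    finally show ?thesis .
  qed
  have g: "?g t \<in> {0..<int ?N}" for t
    using N0 by (simp only: atLeastLessThan_iff) (intro conjI pos_mod_sign pos_mod_bound, simp_all)
  have img: "?g ` ?A \<subseteq> ?U"
    by (intro image_subsetI CollectI conjI g) (simp only: pd moment_set_def mem_Collect_eq simp_thms)
  have "[unit_moment p (zeta_measure m a c) k j = sum (\<lambda>r. sum F {t \<in> ?A. ?g t = r}) ?U] (mod int ?N)"
    unfolding unit_moment_def
  proof (rule cong_sum)
    fix r assume r: "r \<in> ?U"
    then have r': "r \<in> {0..<int ?N}" by simp
    have eq: "{t. t \<in> {0..<int ?N * int m} \<and> t mod int m = int a \<and> ?g t = r} = {t \<in> ?A. ?g t = r}"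
      unfolding moment_set_def using r pd by blast
    have "zeta_measure m a c ?N r ?N = unit_weight m a ?N C r mod int ?N"
      unfolding zeta_measure_def C_def using r' idx by (simp only: restrict_apply' )
    then have "[r ^ k * zeta_measure m a c ?N r ?N = r ^ k * unit_weight m a ?N C r] (mod int ?N)"
      by (intro cong_scalar_left) (simp only: cong_def mod_mod_trivial)
    also have "unit_weight m a ?N C r = sum w {t \<in> ?A. ?g t = r}"
      unfolding unit_weight_def eq w_def by (rule refl)
    also have "r ^ k * sum w {t \<in> ?A. ?g t = r} = sum F {t \<in> ?A. ?g t = r}"
      unfolding sum_distrib_left F_def by (rule sum.cong) auto
    finally show "[r ^ k * zeta_measure m a c ?N r ?N = sum F {t \<in> ?A. ?g t = r}] (mod int ?N)" .
  qed
  also have "sum (\<lambda>r. sum F {t \<in> ?A. ?g t = r}) ?U = sum F ?A"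
    by (rule sum.group[OF fin(2,1) img])
  finally show ?thesis unfolding F_def w_def .
qed

text \<open>Since \<open>p ^ K\<close> exceeds \<open>K\<close>, the multiplicity of
  \<open>p\<close> in \<open>K\<close> is below \<open>K\<close>. Cancelling \<open>K\<close>
  therefore costs fewer than \<open>K\<close> powers of \<open>p\<close>.\<close>

lemma prime_power_dvd_mult_bound:
  fixes K x :: int
  assumes p: "Factorial_Ring.prime p" and K: "K > 0" and dvd: "int p ^ (n + nat K) dvd K * x"
  shows "int p ^ Suc n dvd x"
proof -
  have "\<not> int p ^ nat K dvd K"
  proof
    assume "int p ^ nat K dvd K"
    then have "int p ^ nat K \<le> K" using K by (rule zdvd_imp_le)
    moreover have "nat K < p ^ nat K" using prime_gt_1_nat[OF p] by (intro power_gt_expt) simp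
    then have "int (nat K) < int p ^ nat K" by (metis of_nat_less_iff of_nat_power)
    ultimately show False using K by simp
  qed
  moreover have "int p ^ nat K dvd K \<or> int p ^ Suc n dvd x"
    using dvd p by (intro prime_elem_power_dvd_cases) (auto simp: add.commute)
  ultimately show ?thesis by blast
qed

lemma unit_moment_zeta_measure_bernoulli:
  assumes am: "coprime m a" "m > 1" "0 < a" "a < m"
    and p: "Factorial_Ring.prime p" and k: "k \<ge> 1"
    and c: "c \<in> carrier Zhat" "\<And>N. N > 0 \<Longrightarrow> coprime (c N) (int N)" "[c m = 1] (mod int m)"
    and q: "quotient_of (of_nat m ^ (k - 1) / of_nat k * (bernoulli_poly k (of_nat a / of_nat m) -
       (if p dvd m then 0 else of_nat p ^ (k - 1) * bernoulli_poly k (of_nat (bracket_div m a p) / of_nat m))))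
       = (u, v)"
  obtains j where "j \<ge> n" "j > 0"
    "[unit_moment p (zeta_measure m a c) (k - 1) j * v = (1 - c (p ^ n) ^ k) * u] (mod int (p ^ n))"
proof -
  define R where "R = of_nat m ^ (k - 1) / of_nat k * (bernoulli_poly k (of_nat a / of_nat m) -
       (if p dvd m then 0 else of_nat p ^ (k - 1) * bernoulli_poly k (of_nat (bracket_div m a p) / of_nat m)))"
  obtain K H :: int where K: "K > 0" "of_int H = of_int K * R"
    and moment: "\<And>j C e. coprime C (int (p ^ Suc j) * int m) \<Longrightarrow> [C = 1] (mod int m) \<Longrightarrow>
       [K * (\<Sum>t\<in>moment_set p m a (p ^ Suc j). (C * t mod int (p ^ Suc j)) ^ (k - 1)
              * (e - C * t div (int (p ^ Suc j) * int m))) = (1 - C ^ k) * H] (mod int (p ^ Suc j))"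
    by (rule moment_cong_bernoulli[OF am p k, folded R_def]) (rule that, assumption+)
  have v: "v > 0" and Ruv: "R = of_int u / of_int v"
    using quotient_of_denom_pos[OF q] quotient_of_div[OF q] by (simp_all add: R_def)
  have "of_int (H * v) = (of_int (K * u) :: rat)" using v K(2) by (simp add: Ruv)
  then have Hv: "H * v = K * u" by (simp only: of_int_eq_iff)
  \<comment> \<open>The surplus \<open>nat K\<close> in the exponent pays for cancelling
    \<open>K\<close> at the end and still leaves divisibility by \<open>p ^ n\<close>.\<close>
  define i where "i = n + nat K"
  let ?N = "p ^ Suc i"
  define C where "C = c (2 * ?N * m * ?N)"
  define S where "S = unit_moment p (zeta_measure m a c) (k - 1) (Suc i)"
  have p0: "p > 0" using p by (rule prime_gt_0_nat)
  have m0: "m > 0" using am by simp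
  have compat: "[c M = c N] (mod int N)" if "N dvd M" "M > 0" for N M
    using Zlim_carrierD(1)[OF c(1), of N M] Zlim_carrierD(5)[OF c(1), of N] that
    by (auto simp: Zhat_index_def cong_def dest: dvd_pos_nat)
  have M0: "2 * ?N * m * ?N > 0" using p0 am by simp
  have "coprime C (int (2 * ?N * m * ?N))" unfolding C_def by (rule c(2)[OF M0])
  then have cop: "coprime C (int ?N * int m)" "coprime C (int p)"
    by (auto simp: coprime_mult_right_iff)
  have "[C = c m] (mod int m)" unfolding C_def using M0 by (intro compat) auto
  then have C1: "[C = 1] (mod int m)" using c(3) by (rule cong_trans)
  have Cn: "[C = c (p ^ n)] (mod int (p ^ n))"
  proof -
    have "p ^ n dvd ?N" by (simp add: i_def le_imp_power_dvd)
    then have "p ^ n dvd 2 * ?N * m * ?N" by (rule dvd_mult)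
    then show ?thesis unfolding C_def using M0 by (rule compat)
  qed
  have "[K * S = (1 - C ^ k) * H] (mod int ?N)"
    by (rule cong_trans[OF cong_scalar_left moment[OF cop(1) C1]])
      (unfold S_def C_def, rule unit_moment_zeta_measure[where c = c, OF p zero_less_Suc m0 cop(2)[unfolded C_def]])
  then have "[K * S * v = (1 - C ^ k) * H * v] (mod int ?N)" by (rule cong_scalar_right)
  moreover have "K * S * v - (1 - C ^ k) * H * v = K * (S * v - (1 - C ^ k) * u)"
    by (simp add: mult.assoc Hv right_diff_distrib mult.left_commute)
  ultimately have "int ?N dvd K * (S * v - (1 - C ^ k) * u)" by (simp only: cong_iff_dvd_diff)
  then have "int p ^ (Suc n + nat K) dvd K * (S * v - (1 - C ^ k) * u)" by (simp add: i_def)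
  then have "int p ^ Suc (Suc n) dvd S * v - (1 - C ^ k) * u"
    by (rule prime_power_dvd_mult_bound[OF p K(1)])
  then have "int (p ^ n) dvd S * v - (1 - C ^ k) * u"
    by (metis dvd_trans le_imp_power_dvd of_nat_power le_SucI order_refl)
  then have "[S * v = (1 - C ^ k) * u] (mod int (p ^ n))" by (simp only: cong_iff_dvd_diff)
  also have "[(1 - C ^ k) * u = (1 - c (p ^ n) ^ k) * u] (mod int (p ^ n))"
    by (intro cong_scalar_right cong_diff cong_refl cong_pow Cn)
  finally show ?thesis
    unfolding S_def by (intro that[of "Suc i"]) (simp_all add: i_def)
qed

section \<open>The measure attached to an automorphism and its moments at all primes\<close>

theorem theorem1p1:
  fixes m a :: nat
  assumes "coprime m a" and "m > 1" and "0 < a" and "a < m"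
  shows "\<forall>\<sigma> \<in> absolute_Galois_group (cyclotomic_field m).
    \<exists>\<mu> \<in> measure_algebra Zhat_index Zhat_index.
      \<forall>p::nat. Factorial_Ring.prime p \<longrightarrow> (\<forall>k\<ge>1.
        Qp_of_Zp p (padic_integral p (Units (Zp p)) (\<lambda>b. b [^]\<^bsub>Zp p\<^esub> (k - 1 :: nat))
                      (measure_image p \<mu>)) =
        (\<one>\<^bsub>Qp p\<^esub> \<ominus>\<^bsub>Qp p\<^esub> Qp_of_Zp p (cyclotomic_character p \<sigma>) [^]\<^bsub>Qp p\<^esub> k) \<otimes>\<^bsub>Qp p\<^esub>
        Qp_of_rat p
          (if p dvd m
           then of_nat m ^ (k - 1) * (1 / of_nat k * bernoulli_poly k (of_nat a / of_nat m))
           else of_nat m ^ (k - 1) *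
             (1 / of_nat k * bernoulli_poly k (of_nat a / of_nat m)
              - of_nat p ^ (k - 1) / of_nat k *
                bernoulli_poly k (of_nat (bracket_div m a p) / of_nat m))))"
proof
  fix \<sigma> assume \<sigma>: "\<sigma> \<in> absolute_Galois_group (cyclotomic_field m)"
  have m: "m > 0" using assms(2) by simp
  \<comment> \<open>The exponent \<open>c\<close> depends on \<sigma> alone, so the measure built
    from it is fixed before any prime is chosen.\<close>
  obtain c where c: "c \<in> carrier Zhat" "\<And>N. N > 0 \<Longrightarrow> coprime (c N) (int N)" "[c m = 1] (mod int m)"
    and act: "\<And>N z. N > 0 \<Longrightarrow> z ^ N = 1 \<Longrightarrow> \<sigma> z = z ^ nat (c N)"
    using Galois_acts_on_roots_of_unity[OF \<sigma> m] by metis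
  let ?\<nu> = "zeta_measure m a c"
  have \<nu>: "?\<nu> \<in> measure_algebra Zhat_index Zhat_index"
    by (rule zeta_measure_in_measure_algebra[OF m c(1,2)])
  show "\<exists>\<mu> \<in> measure_algebra Zhat_index Zhat_index.
      \<forall>p::nat. Factorial_Ring.prime p \<longrightarrow> (\<forall>k\<ge>1.
        Qp_of_Zp p (padic_integral p (Units (Zp p)) (\<lambda>b. b [^]\<^bsub>Zp p\<^esub> (k - 1 :: nat))
                      (measure_image p \<mu>)) =
        (\<one>\<^bsub>Qp p\<^esub> \<ominus>\<^bsub>Qp p\<^esub> Qp_of_Zp p (cyclotomic_character p \<sigma>) [^]\<^bsub>Qp p\<^esub> k) \<otimes>\<^bsub>Qp p\<^esub>
        Qp_of_rat p
          (if p dvd m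
           then of_nat m ^ (k - 1) * (1 / of_nat k * bernoulli_poly k (of_nat a / of_nat m))
           else of_nat m ^ (k - 1) *
             (1 / of_nat k * bernoulli_poly k (of_nat a / of_nat m)
              - of_nat p ^ (k - 1) / of_nat k *
                bernoulli_poly k (of_nat (bracket_div m a p) / of_nat m))))"
  proof (intro bexI[OF _ \<nu>] allI impI)
    fix p k :: nat assume p: "Factorial_Ring.prime p" and k: "1 \<le> k"
    \<comment> \<open>A common form of the two cases, in which the second Bernoulli term is switched
      off when \<open>p\<close> divides \<open>m\<close>.\<close>
    let ?R = "of_nat m ^ (k - 1) / of_nat k * (bernoulli_poly k (of_nat a / of_nat m) -
       (if p dvd m then 0 else of_nat p ^ (k - 1) * bernoulli_poly k (of_nat (bracket_div m a p) / of_nat m)))"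
    have R: "(if p dvd m
           then of_nat m ^ (k - 1) * (1 / of_nat k * bernoulli_poly k (of_nat a / of_nat m))
           else of_nat m ^ (k - 1) *
             (1 / of_nat k * bernoulli_poly k (of_nat a / of_nat m)
              - of_nat p ^ (k - 1) / of_nat k *
                bernoulli_poly k (of_nat (bracket_div m a p) / of_nat m))) = ?R"
      by (simp add: diff_divide_distrib right_diff_distrib)
    have p0: "p > 0" using p by (rule prime_gt_0_nat)
    have \<chi>: "cyclotomic_character p \<sigma> = restrict c (Zp_index p)"
      by (rule cyclotomic_character_eq_restrict[OF c(1) act p0])
    have \<chi>car: "restrict c (Zp_index p) \<in> carrier (Zp p)"
      using p0 by (intro Zlim_restrict_carrier[OF c(1)]) (auto simp: Zp_index_def Zhat_index_def)
    let ?I = "padic_integral p (Units (Zp p)) (\<lambda>b. b [^]\<^bsub>Zp p\<^esub> (k - 1)) (measure_image p ?\<nu>)"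
    note I = padic_integral_power_Units[OF \<nu> p, where k = "k - 1"]
    obtain u v where uv: "quotient_of ?R = (u, v)" by (rule prod.exhaust)
    show "Qp_of_Zp p ?I = (\<one>\<^bsub>Qp p\<^esub> \<ominus>\<^bsub>Qp p\<^esub> Qp_of_Zp p (cyclotomic_character p \<sigma>) [^]\<^bsub>Qp p\<^esub> k) \<otimes>\<^bsub>Qp p\<^esub>
        Qp_of_rat p
          (if p dvd m
           then of_nat m ^ (k - 1) * (1 / of_nat k * bernoulli_poly k (of_nat a / of_nat m))
           else of_nat m ^ (k - 1) *
             (1 / of_nat k * bernoulli_poly k (of_nat a / of_nat m)
              - of_nat p ^ (k - 1) / of_nat k *
                bernoulli_poly k (of_nat (bracket_div m a p) / of_nat m)))"
      unfolding R \<chi>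
    proof (rule Qp_eqI[OF p I(1) \<chi>car uv])
      \<comment> \<open>Each component may use its own \<open>j\<close>: modulo \<open>p ^ n\<close>
        the integral is the unit moment at any positive level from \<open>n\<close> on, so one
        sufficiently precise level is enough.\<close>
      fix n
      obtain j where j: "n \<le> j" "0 < j"
        "[unit_moment p ?\<nu> (k - 1) j * v = (1 - c (p ^ n) ^ k) * u] (mod int (p ^ n))"
        using unit_moment_zeta_measure_bernoulli[OF assms p k c uv, of n] by metis
      have "[?I (p ^ n) * v = unit_moment p ?\<nu> (k - 1) j * v] (mod int (p ^ n))"
        by (rule cong_scalar_right[OF I(2)[OF j(1,2)]])
      from cong_trans[OF this j(3)]
      show "[?I (p ^ n) * v = (1 - restrict c (Zp_index p) (p ^ n) ^ k) * u] (mod int (p ^ n))"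
        by (simp only: restrict_apply' power_in_Zp_index)
    qed
  qed
qed

end
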